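(* Let $K\subset\mathbb{R}^2$ be a convex compact set. Then the operator system $A(K)$ is hyperrigid in the C*-algebra $C(\mathrm{ex}(K))$; that is, for every Hilbert space $H$, every unital $*$-homomorphism $\pi:C(\mathrm{ex}(K))\to\mathcal{B}(H)$ and every unital completely positive map $\phi:C(\mathrm{ex}(K))\to\mathcal{B}(H)$ with $\phi(f)=\pi(f)$ for all $f\in A(K)$, one has $\phi=\pi$.
   Context: $\mathrm{ex}(K)$ denotes the set of extreme points of $K$ (it is closed for compact convex $K\subset\mathbb{R}^2$). $C(\mathrm{ex}(K))$ is the C*-algebra of complex-valued continuous functions on $\mathrm{ex}(K)$. $A(K)$ is the operator system of all continuous affine (complex-valued) functions on $K$, regarded as a subspace of $C(\mathrm{ex}(K))$ by restriction to $\mathrm{ex}(K)$. An operator system $S$ generating a C*-algebra $C^*(S)$ is called hyperrigid (in $C^*(S)$) if every unital $*$-homomorphism $\pi:C^*(S)\to\mathcal{B}(H)$ has the unique extension property: the only unital completely positive map $\phi:C^*(S)\to\mathcal{B}(H)$ with $\phi|_S=\pi|_S$ is $\pi$ itself. *)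

theory Defs
  imports "HOL-Analysis.Analysis"
begin

(* Complex Hilbert spaces. The inner product is conjugate-linear in the first argument and linear
   in the second. Positive semidefiniteness and definiteness of cinner follow from the last axiom. *)
class chilbert_space = banach +
  fixes scaleC :: "complex \<Rightarrow> 'a \<Rightarrow> 'a" (infixr "*\<^sub>C" 75)
    and cinner :: "'a \<Rightarrow> 'a \<Rightarrow> complex"
  assumes scaleC_add_right: "c *\<^sub>C (x + y) = c *\<^sub>C x + c *\<^sub>C y"
    and scaleC_add_left: "(c + d) *\<^sub>C x = c *\<^sub>C x + d *\<^sub>C x"
    and scaleC_scaleC: "c *\<^sub>C (d *\<^sub>C x) = (c * d) *\<^sub>C x"
    and scaleC_of_real: "complex_of_real r *\<^sub>C x = r *\<^sub>R x"
    and cinner_commute: "cinner x y = cnj (cinner y x)"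
    and cinner_add_right: "cinner x (y + z) = cinner x y + cinner x z"
    and cinner_scaleC_right: "cinner x (c *\<^sub>C y) = c * cinner x y"
    and cinner_self: "cinner x x = complex_of_real ((norm x)\<^sup>2)"

instantiation complex :: chilbert_space
begin

definition scaleC_complex :: "complex \<Rightarrow> complex \<Rightarrow> complex" where
  "scaleC_complex c x = c * x"

definition cinner_complex :: "complex \<Rightarrow> complex \<Rightarrow> complex" where
  "cinner_complex x y = cnj x * y"

instance
proof
  fix x :: complex
  show "cinner x x = complex_of_real ((norm x)\<^sup>2)"
    by (simp only: cinner_complex_def complex_norm_square mult.commute)
qed (simp_all add: scaleC_complex_def cinner_complex_def algebra_simps scaleR_conv_of_real)

end

(* B(H): the complex-linear members of the library's space of bounded real-linear operators. *)
definition bounded_ops :: "('h::chilbert_space \<Rightarrow>\<^sub>L 'h) set" where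
  "bounded_ops = {T. \<forall>c x. blinfun_apply T (c *\<^sub>C x) = c *\<^sub>C blinfun_apply T x}"

(* An element of C(X) is represented by its extension by 0 outside X. Hence distinct members of
   C(X) differ on X, the pointwise operations stay in C(X), and the unit is the indicator of X. *)
definition cfun_algebra :: "'a::topological_space set \<Rightarrow> ('a \<Rightarrow> complex) set" where
  "cfun_algebra X = {f. continuous_on X f \<and> (\<forall>x. x \<notin> X \<longrightarrow> f x = 0)}"

definition cfun_one :: "'a set \<Rightarrow> 'a \<Rightarrow> complex" where
  "cfun_one X = (\<lambda>x. if x \<in> X then 1 else 0)"

definition unital_linear_map ::
    "'a::topological_space set \<Rightarrow> (('a \<Rightarrow> complex) \<Rightarrow> ('h::chilbert_space \<Rightarrow>\<^sub>L 'h)) \<Rightarrow> bool" where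
  "unital_linear_map X \<phi> \<longleftrightarrow>
     (\<forall>f\<in>cfun_algebra X. \<phi> f \<in> bounded_ops) \<and>
     (\<forall>f\<in>cfun_algebra X. \<forall>g\<in>cfun_algebra X. \<phi> (\<lambda>x. f x + g x) = \<phi> f + \<phi> g) \<and>
     (\<forall>c. \<forall>f\<in>cfun_algebra X. \<forall>v.
        blinfun_apply (\<phi> (\<lambda>x. c * f x)) v = c *\<^sub>C blinfun_apply (\<phi> f) v) \<and>
     \<phi> (cfun_one X) = id_blinfun"

(* The last conjunct says that the image of the conjugate of f is the adjoint of the image of f. *)
definition unital_star_hom ::
    "'a::topological_space set \<Rightarrow> (('a \<Rightarrow> complex) \<Rightarrow> ('h::chilbert_space \<Rightarrow>\<^sub>L 'h)) \<Rightarrow> bool" where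
  "unital_star_hom X \<pi> \<longleftrightarrow>
     unital_linear_map X \<pi> \<and>
     (\<forall>f\<in>cfun_algebra X. \<forall>g\<in>cfun_algebra X. \<pi> (\<lambda>x. f x * g x) = \<pi> f o\<^sub>L \<pi> g) \<and>
     (\<forall>f\<in>cfun_algebra X. \<forall>v w.
        cinner (blinfun_apply (\<pi> (\<lambda>x. cnj (f x))) v) w = cinner v (blinfun_apply (\<pi> f) w))"

(* F is positive in the C*-algebra of n x n matrices over C(X): F = B* B for such a matrix B. *)
definition positive_cfun_matrix ::
    "'a::topological_space set \<Rightarrow> nat \<Rightarrow> (nat \<Rightarrow> nat \<Rightarrow> 'a \<Rightarrow> complex) \<Rightarrow> bool" where
  "positive_cfun_matrix X n F \<longleftrightarrow>
     (\<exists>B. (\<forall>i<n. \<forall>j<n. B i j \<in> cfun_algebra X) \<and>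
          (\<forall>i<n. \<forall>j<n. F i j = (\<lambda>x. \<Sum>k<n. cnj (B k i x) * B k j x)))"

(* The n x n operator matrix T is positive as an operator on the direct sum of n copies of H. *)
definition positive_op_matrix :: "nat \<Rightarrow> (nat \<Rightarrow> nat \<Rightarrow> ('h::chilbert_space \<Rightarrow>\<^sub>L 'h)) \<Rightarrow> bool" where
  "positive_op_matrix n T \<longleftrightarrow>
     (\<forall>v. (\<Sum>i<n. cinner (v i) (\<Sum>j<n. blinfun_apply (T i j) (v j))) \<in> \<real>\<^sub>\<ge>\<^sub>0)"

definition ucp_map ::
    "'a::topological_space set \<Rightarrow> (('a \<Rightarrow> complex) \<Rightarrow> ('h::chilbert_space \<Rightarrow>\<^sub>L 'h)) \<Rightarrow> bool" where
  "ucp_map X \<phi> \<longleftrightarrow>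
     unital_linear_map X \<phi> \<and>
     (\<forall>n F. positive_cfun_matrix X n F \<longrightarrow> positive_op_matrix n (\<lambda>i j. \<phi> (F i j)))"

definition unique_extension_property ::
    "'a::topological_space set \<Rightarrow> ('a \<Rightarrow> complex) set \<Rightarrow>
     (('a \<Rightarrow> complex) \<Rightarrow> ('h::chilbert_space \<Rightarrow>\<^sub>L 'h)) \<Rightarrow> bool" where
  "unique_extension_property X S \<pi> \<longleftrightarrow>
     (\<forall>\<phi>. ucp_map X \<phi> \<and> (\<forall>f\<in>S. \<phi> f = \<pi> f) \<longrightarrow> (\<forall>f\<in>cfun_algebra X. \<phi> f = \<pi> f))"

(* Hyperrigidity of S in C(X), tested on the Hilbert space 'h. A definition cannot quantify over
   types, so "for every Hilbert space" is expressed by a theorem about an arbitrary type 'h. *)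
definition hyperrigid ::
    "'h::chilbert_space itself \<Rightarrow> 'a::topological_space set \<Rightarrow> ('a \<Rightarrow> complex) set \<Rightarrow> bool" where
  "hyperrigid _ X S \<longleftrightarrow>
     (\<forall>\<pi> :: ('a \<Rightarrow> complex) \<Rightarrow> ('h \<Rightarrow>\<^sub>L 'h). unital_star_hom X \<pi> \<longrightarrow> unique_extension_property X S \<pi>)"

definition extreme_points :: "'a::real_vector set \<Rightarrow> 'a set" where
  "extreme_points K = {x. x extreme_point_of K}"

definition continuous_affine_on :: "'a::real_normed_vector set \<Rightarrow> ('a \<Rightarrow> complex) \<Rightarrow> bool" where
  "continuous_affine_on K g \<longleftrightarrow>
     continuous_on K g \<and>
     (\<forall>x\<in>K. \<forall>y\<in>K. \<forall>t\<in>{0..1}. g ((1 - t) *\<^sub>R x + t *\<^sub>R y) = (1 - t) *\<^sub>R g x + t *\<^sub>R g y)"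

(* A(K), restricted to the extreme points of K *)
definition affine_functions :: "'a::real_normed_vector set \<Rightarrow> ('a \<Rightarrow> complex) set" where
  "affine_functions K =
     {f \<in> cfun_algebra (extreme_points K).
        \<exists>g. continuous_affine_on K g \<and> (\<forall>x\<in>extreme_points K. f x = g x)}"

definition operator_system :: "'a::topological_space set \<Rightarrow> ('a \<Rightarrow> complex) set \<Rightarrow> bool" where
  "operator_system X S \<longleftrightarrow>
     S \<subseteq> cfun_algebra X \<and> cfun_one X \<in> S \<and>
     (\<forall>f\<in>S. \<forall>g\<in>S. (\<lambda>x. f x + g x) \<in> S) \<and>
     (\<forall>c. \<forall>f\<in>S. (\<lambda>x. c * f x) \<in> S) \<and>
     (\<forall>f\<in>S. (\<lambda>x. cnj (f x)) \<in> S)"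

lemma operator_system_affine_functions:
  "operator_system (extreme_points K) (affine_functions K)"
proof -
  let ?E = "extreme_points K"
  have one: "cfun_one ?E \<in> affine_functions K"
  proof -
    have "continuous_on ?E (cfun_one ?E)"
      by (rule continuous_on_eq[OF continuous_on_const[of _ 1]]) (simp add: cfun_one_def)
    moreover have "continuous_affine_on K (\<lambda>_. 1)"
      by (simp add: continuous_affine_on_def scaleR_conv_of_real)
    ultimately show ?thesis
      unfolding affine_functions_def cfun_algebra_def
      by (auto simp: cfun_one_def intro!: exI[of _ "\<lambda>_. 1"])
  qed
  have add: "(\<lambda>x. f x + g x) \<in> affine_functions K"
    if fg: "f \<in> affine_functions K" "g \<in> affine_functions K" for f g
  proof -
    obtain f' where f': "continuous_affine_on K f'" "\<forall>x\<in>?E. f x = f' x"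
      using fg(1) unfolding affine_functions_def by auto
    obtain g' where g': "continuous_affine_on K g'" "\<forall>x\<in>?E. g x = g' x"
      using fg(2) unfolding affine_functions_def by auto
    from f' g' have "continuous_affine_on K (\<lambda>x. f' x + g' x) \<and> (\<forall>x\<in>?E. f x + g x = f' x + g' x)"
      unfolding continuous_affine_on_def by (auto intro!: continuous_intros simp: scaleR_add_right add_ac)
    moreover have "(\<lambda>x. f x + g x) \<in> cfun_algebra ?E"
      using fg unfolding affine_functions_def cfun_algebra_def
      by (simp add: continuous_on_add)
    ultimately show ?thesis
      unfolding affine_functions_def by blast
  qed
  have scale: "(\<lambda>x. c * f x) \<in> affine_functions K" if f: "f \<in> affine_functions K" for c f
  proof -
    obtain f' where "continuous_affine_on K f'" "\<forall>x\<in>?E. f x = f' x"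
      using f unfolding affine_functions_def by auto
    then have "continuous_affine_on K (\<lambda>x. c * f' x) \<and> (\<forall>x\<in>?E. c * f x = c * f' x)"
      unfolding continuous_affine_on_def
      by (auto intro!: continuous_intros simp: distrib_left)
    moreover have "(\<lambda>x. c * f x) \<in> cfun_algebra ?E"
      using f unfolding affine_functions_def cfun_algebra_def
      by (simp add: continuous_on_mult_left)
    ultimately show ?thesis
      unfolding affine_functions_def by blast
  qed
  have conj: "(\<lambda>x. cnj (f x)) \<in> affine_functions K" if f: "f \<in> affine_functions K" for f
  proof -
    obtain f' where "continuous_affine_on K f'" "\<forall>x\<in>?E. f x = f' x"
      using f unfolding affine_functions_def by auto
    then have "continuous_affine_on K (\<lambda>x. cnj (f' x)) \<and> (\<forall>x\<in>?E. cnj (f x) = cnj (f' x))"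
      unfolding continuous_affine_on_def
      by (auto intro!: continuous_on_cnj simp: scaleR_conv_of_real)
    moreover have "(\<lambda>x. cnj (f x)) \<in> cfun_algebra ?E"
      using f unfolding affine_functions_def cfun_algebra_def
      by (simp add: continuous_on_cnj)
    ultimately show ?thesis
      unfolding affine_functions_def by blast
  qed
  show ?thesis
    unfolding operator_system_def
    using one add scale conj by (auto simp: affine_functions_def)
qed

end

theory Submission
  imports Defs
begin

text \<open>Let \<open>f\<close> be a coordinate of the plane and let \<open>N v = \<langle>v, \<phi>(f\<^sup>2) v\<rangle> - \<parallel>\<phi>(f) v\<parallel>\<^sup>2\<close>, which is nonnegative by
  the Kadison--Schwarz inequality. If \<open>N = 0\<close> for both coordinates, they lie in the multiplicative domain
  of \<open>\<phi>\<close>, and Stone--Weierstrass gives \<open>\<phi> = \<pi>\<close>.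

  If an affine function \<open>A\<close> satisfies \<open>A \<ge> (f - c)\<^sup>2\<close> on \<open>ex K\<close> and \<open>A \<le> \<kappa>\<close> on the support of \<open>u\<close>, then
  \<open>N (\<pi>(u) v) \<le> \<kappa> \<parallel>\<pi>(u) v\<parallel>\<^sup>2\<close>, because \<open>\<phi>(A) = \<pi>(A)\<close>. Decomposing \<open>v\<close> by a partition of unity,
  \<open>N v \<le> (\<Sum>p. \<kappa> p) \<parallel>v\<parallel>\<^sup>2\<close> for every cover of \<open>ex K\<close> by such patches, so it remains to find covers with
  \<open>\<Sum>p. \<kappa> p\<close> arbitrarily small. At any single extreme point \<open>\<kappa>\<close> can be made arbitrarily small, which deals
  with countably many points. The remaining points \<open>p\<close> are exposed by a functional \<open>l\<close> whose kernel is the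
  only supporting line at \<open>p\<close>; a thin cap cut off by a level line of \<open>l\<close> has height negligible compared
  with its \<open>f\<close>-width \<open>s\<close>, and this yields \<open>\<kappa> \<le> \<epsilon> s\<close>. In a minimal cover every boundary point of \<open>K\<close> lies
  in at most two caps (a Radon-type argument in the plane), hence the widths sum to at most four times the
  \<open>f\<close>-width of \<open>K\<close>.\<close>

subsection \<open>Caps of planar convex sets\<close>

lemma inner_plane:
  fixes a x :: "real ^ 2"
  assumes "i \<noteq> j"
  shows "a \<bullet> x = a $ i * x $ i + a $ j * x $ j"
  using assms exhaust_2[of i] exhaust_2[of j] by (auto simp: inner_vec_def sum_2)

lemma eq_plane:
  fixes x y :: "real ^ 2"
  assumes "i \<noteq> j"
  shows "x = y \<longleftrightarrow> x $ i = y $ i \<and> x $ j = y $ j"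
  using assms exhaust_2[of i] exhaust_2[of j] by (auto simp: vec_eq_iff forall_2)

text \<open>If \<open>K\<close> has empty interior, it lies in a hyperplane and the normal is
  constant on \<open>K\<close>. Otherwise interior and relative interior coincide, and the
  supporting hyperplane theorem for relative boundary points applies.\<close>

lemma supporting_functional:
  fixes K :: "'a::euclidean_space set"
  assumes "convex K" "x \<in> K" "x \<notin> interior K"
  obtains a where "a \<noteq> 0" "\<And>y. y \<in> K \<Longrightarrow> a \<bullet> x \<le> a \<bullet> y"
proof (cases "interior K = {}")
  case True
  then obtain a b where ab: "a \<noteq> 0" "K \<subseteq> {x. a \<bullet> x = b}"
    using empty_interior_subset_hyperplane[OF assms(1)] by metis
  have "a \<bullet> x \<le> a \<bullet> y" if "y \<in> K" for y
  proof -
    have "a \<bullet> x = b" "a \<bullet> y = b"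
      using ab(2) assms(2) that by blast+
    then show ?thesis by simp
  qed
  then show ?thesis
    using that ab(1) by blast
next
  case False
  then have "x \<notin> rel_interior K"
    using assms(3) rel_interior_nonempty_interior by blast
  then show ?thesis
    using supporting_hyperplane_rel_boundary[OF assms(1,2)] that by metis
qed

text \<open>Separate the point \<open>(p, g p + e)\<close> from the compact convex hull of the graph of \<open>g\<close>: as \<open>p\<close> is
  extreme, the only point of that hull above \<open>p\<close> is \<open>(p, g p)\<close>.\<close>

lemma extreme_point_affine_majorant:
  fixes K :: "'a::euclidean_space set" and g :: "'a \<Rightarrow> real"
  assumes K: "convex K" "compact K" and p: "p extreme_point_of K"
    and g: "continuous_on K g" and e: "e > 0"
  obtains b c where "\<And>x. x \<in> K \<Longrightarrow> g x \<le> c + b \<bullet> x" "c + b \<bullet> p < g p + e"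
proof -
  define H where "H = convex hull ((\<lambda>x. (x, g x)) ` K)"
  \<comment> \<open>\<open>S\<close> constrains only the fibre over \<open>p\<close>. Its convexity
    is where extremality of \<open>p\<close> enters: a point over \<open>p\<close> can only be a
    combination of points over \<open>p\<close>.\<close>
  define S where "S = {(x, t). x \<in> K \<and> (x = p \<longrightarrow> t = g p)}"
  have pK: "p \<in> K"
    using p by (simp add: extreme_point_of_def)
  have "convex S"
    unfolding convex_alt
  proof (intro ballI allI impI)
    fix z1 z2 u assume z: "z1 \<in> S" "z2 \<in> S" and u: "0 \<le> u \<and> u \<le> (1::real)"
    obtain x1 t1 x2 t2 where [simp]: "z1 = (x1, t1)" "z2 = (x2, t2)"
      by (metis surj_pair)
    have x: "x1 \<in> K" "x2 \<in> K"
      using z by (auto simp: S_def)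
    have "(1 - u) *\<^sub>R x1 + u *\<^sub>R x2 \<in> K"
      using K(1) x u by (auto simp: convex_alt)
    moreover have "(1 - u) * t1 + u * t2 = g p" if eq: "(1 - u) *\<^sub>R x1 + u *\<^sub>R x2 = p"
    proof (cases "u = 0 \<or> u = 1")
      case True
      then show ?thesis using z eq by (auto simp: S_def)
    next
      case False
      have "x1 = x2"
      proof (rule ccontr)
        assume "x1 \<noteq> x2"
        then have "p \<in> open_segment x1 x2"
          using u False unfolding in_segment by (intro conjI exI[of _ u] eq[symmetric]) auto
        then show False
          using p x by (auto simp: extreme_point_of_def)
      qed
      then have "x1 = p" "x2 = p"
        using eq by (auto simp: algebra_simps)
      then show ?thesis
        using z by (auto simp: S_def algebra_simps)
    qed
    ultimately show "(1 - u) *\<^sub>R z1 + u *\<^sub>R z2 \<in> S"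
      by (auto simp: S_def)
  qed
  moreover have "(\<lambda>x. (x, g x)) ` K \<subseteq> S"
    by (auto simp: S_def)
  ultimately have HS: "H \<subseteq> S"
    unfolding H_def by (rule hull_minimal[rotated])
  have "compact ((\<lambda>x. (x, g x)) ` K)"
    using K(2) g by (intro compact_continuous_image continuous_intros)
  then have "closed H"
    unfolding H_def by (intro compact_imp_closed compact_convex_hull)
  moreover have "convex H"
    by (simp add: H_def)
  moreover have "(p, g p + e) \<notin> H"
    using HS e by (auto simp: S_def)
  ultimately obtain z d where z: "z \<bullet> (p, g p + e) < d" "\<And>y. y \<in> H \<Longrightarrow> z \<bullet> y > d"
    using separating_hyperplane_closed_point by metis
  obtain a s where [simp]: "z = (a, s)"
    by (metis surj_pair)
  have above: "a \<bullet> x + s * g x > d" if "x \<in> K" for x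
    using z(2)[of "(x, g x)"] that by (auto simp: H_def hull_inc)
  have below: "a \<bullet> p + s * (g p + e) < d"
    using z(1) by simp
  \<comment> \<open>Comparing the graph point over \<open>p\<close> with the point raised by
    \<open>e\<close> fixes the sign of the last component of the normal. The hyperplane is therefore
    not vertical and can be solved for the height.\<close>
  have "s * e < 0"
    using above[OF pK] below by (simp add: algebra_simps)
  then have s: "s < 0"
    using e by (simp add: mult_less_0_iff)
  show ?thesis
  proof (rule that[of "- d / - s" "(1 / - s) *\<^sub>R a"])
    fix x assume "x \<in> K"
    then show "g x \<le> - d / - s + (1 / - s) *\<^sub>R a \<bullet> x"
      using above[of x] s by (simp add: field_simps)
  next
    show "- d / - s + (1 / - s) *\<^sub>R a \<bullet> p < g p + e"
      using below s by (simp add: field_simps)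
  qed
qed

text \<open>Every \<open>x \<in> K\<close> outside a cap has, by convexity, \<open>\<bar>w \<bullet> (x - p)\<bar>\<close> bounded by the
  \<open>w\<close>-width of the cap times the ratio of the heights.\<close>

lemma cap_majorant:
  fixes K :: "'a::euclidean_space set"
  assumes K: "convex K" "compact K" and p: "p \<in> K"
    and exposed: "\<And>x. x \<in> K \<Longrightarrow> x \<noteq> p \<Longrightarrow> a \<bullet> p < a \<bullet> x"
    and flat: "\<And>e. e > 0 \<Longrightarrow> \<exists>x\<in>K. x \<noteq> p \<and> a \<bullet> (x - p) < e * \<bar>w \<bullet> (x - p)\<bar>"
    and \<delta>: "\<delta> > 0"
  obtains r \<kappa> b c where "a \<bullet> p < r" "\<kappa> \<ge> 0" "\<And>x. x \<in> K \<Longrightarrow> (w \<bullet> x - w \<bullet> p)\<^sup>2 \<le> c + b \<bullet> x"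
    "\<And>x. x \<in> K \<Longrightarrow> a \<bullet> x < r \<Longrightarrow> c + b \<bullet> x \<le> \<kappa>"
    "\<kappa> \<le> \<delta> * measure lebesgue ((\<bullet>) w ` {x\<in>K. a \<bullet> x < r})"
proof -
  define l where "l = (\<lambda>x. a \<bullet> (x - p))"
  define f where "f = (\<lambda>x. w \<bullet> (x - p))"
  have lpos: "l x \<ge> 0" if "x \<in> K" for x
    using exposed[OF that] by (cases "x = p") (auto simp: l_def inner_diff_right)
  obtain R where R: "R > 0" "\<And>x. x \<in> K \<Longrightarrow> \<bar>f x\<bar> \<le> R"
  proof -
    have "compact (f ` K)"
      unfolding f_def using K(2) by (intro compact_continuous_image continuous_intros)
    then obtain R where "R > 0" "\<forall>z\<in>f ` K. norm z \<le> R"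
      using bounded_pos compact_imp_bounded by blast
    then show ?thesis
      using that[of R] by auto
  qed
  \<comment> \<open>With this value the terms \<open>t * s\<close> and \<open>2 * t * s\<close> of
    the final bound add up to \<open>\<delta> * s / 2\<close>, half of the allowance.\<close>
  define t where "t = \<delta> / 6"
  have t: "t > 0" using \<delta> by (simp add: t_def)
  \<comment> \<open>Away from \<open>p\<close> in the direction \<open>w\<close>, exposedness and
    compactness keep the height \<open>l\<close> bounded below.\<close>
  obtain m where m: "m > 0" "\<And>x. x \<in> K \<Longrightarrow> \<bar>f x\<bar> \<ge> t \<Longrightarrow> l x \<ge> m"
  proof (cases "{x\<in>K. \<bar>f x\<bar> \<ge> t} = {}")
    case True
    then show ?thesis using that[of 1] by auto
  next
    case False
    have "closed {x. \<bar>f x\<bar> \<ge> t}"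
      unfolding f_def by (intro closed_Collect_le continuous_intros)
    then have "compact {x\<in>K. \<bar>f x\<bar> \<ge> t}"
      using compact_Int_closed[OF K(2), of "{x. \<bar>f x\<bar> \<ge> t}"] by (simp add: Int_def)
    moreover have "continuous_on {x\<in>K. \<bar>f x\<bar> \<ge> t} l"
      unfolding l_def by (intro continuous_intros)
    ultimately obtain z where z: "z \<in> K" "\<bar>f z\<bar> \<ge> t" "\<And>x. x \<in> K \<Longrightarrow> \<bar>f x\<bar> \<ge> t \<Longrightarrow> l z \<le> l x"
      using continuous_attains_inf[OF _ False, of l] by auto
    then have "z \<noteq> p"
      using t by (auto simp: f_def)
    then have "l z > 0"
      using exposed[OF z(1)] by (simp add: l_def inner_diff_right)
    then show ?thesis
      using that z(3) by blast
  qed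
  \<comment> \<open>Chosen so that \<open>\<eta> \<le> 2 * (e * s)\<close> turns the term
    \<open>R\<^sup>2 / m * \<eta>\<close> into at most \<open>\<delta> * s / 2\<close>, the other
    half of the allowance.\<close>
  define e where "e = \<delta> * m / (4 * R\<^sup>2)"
  have "e > 0"
    using \<delta> m R by (simp add: e_def)
  then obtain x0 where x0: "x0 \<in> K" "x0 \<noteq> p" "l x0 < e * \<bar>f x0\<bar>"
    using flat unfolding l_def f_def by blast
  \<comment> \<open>Twice the height of \<open>x0\<close> puts \<open>x0\<close> strictly inside the
    cap, so that \<open>\<bar>f x0\<bar>\<close> is at most the width \<open>s\<close>.\<close>
  define \<eta> where "\<eta> = 2 * l x0"
  have lx0: "l x0 > 0"
    using exposed[OF x0(1,2)] by (simp add: l_def inner_diff_right)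
  then have \<eta>: "\<eta> > 0" by (simp add: \<eta>_def)
  define r where "r = a \<bullet> p + \<eta>"
  have cap: "a \<bullet> x < r \<longleftrightarrow> l x < \<eta>" for x
    by (auto simp: r_def l_def inner_diff_right)
  define C where "C = {x\<in>K. l x < \<eta>}"
  define J where "J = (\<bullet>) w ` C"
  define s where "s = measure lebesgue J"
  have "convex C"
  proof -
    have "C = K \<inter> {x. a \<bullet> x < r}"
      by (auto simp: C_def cap)
    then show ?thesis
      using K(1) by (simp add: convex_Int convex_halfspace_lt)
  qed
  then have J: "convex J"
    unfolding J_def by (intro convex_linear_image bounded_linear.linear bounded_linear_inner_right)
  have "bounded ((\<bullet>) w ` K)"
    using K(2) by (intro compact_imp_bounded compact_continuous_image continuous_intros)
  then have "bounded J"
    by (rule bounded_subset) (auto simp: J_def C_def)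
  then have Jm: "J \<in> lmeasurable"
    using J by (rule measurable_convex[rotated])
  have pC: "p \<in> C"
    using p \<eta> by (simp add: C_def l_def)
  have s0: "s \<ge> 0" by (simp add: s_def)
  have in_cap: "\<bar>f x\<bar> \<le> s" if "x \<in> C" for x
  proof -
    have "w \<bullet> p \<in> J" "w \<bullet> x \<in> J"
      using pC that by (auto simp: J_def)
    then have "closed_segment (w \<bullet> p) (w \<bullet> x) \<subseteq> J"
      using J by (simp add: closed_segment_subset)
    then have "measure lebesgue (closed_segment (w \<bullet> p) (w \<bullet> x)) \<le> s"
      unfolding s_def by (intro measure_mono_fmeasurable Jm) (simp_all add: closed_segment_eq_real_ivl)
    then show ?thesis
      by (simp add: closed_segment_eq_real_ivl f_def inner_diff_right split: if_splits)
  qed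
  have width: "\<bar>f x\<bar> \<le> s + 2 * s * l x / \<eta>" if x: "x \<in> K" for x
  proof (cases "l x < \<eta>")
    case True
    then show ?thesis
      using in_cap[of x] x s0 lpos[OF x] \<eta> by (simp add: C_def add_increasing2)
  next
    case False
    \<comment> \<open>Shrinking \<open>x\<close> towards \<open>p\<close> by this factor brings it
      to height \<open>\<eta> / 2\<close>, hence into the cap.\<close>
    define \<tau> where "\<tau> = \<eta> / (2 * l x)"
    have l: "l x > 0" using False \<eta> by linarith
    have \<tau>: "0 < \<tau>" "\<tau> \<le> 1" "\<tau> * l x < \<eta>"
      using False \<eta> l by (auto simp: \<tau>_def field_simps)
    define y where "y = (1 - \<tau>) *\<^sub>R p + \<tau> *\<^sub>R x"
    have y: "y - p = \<tau> *\<^sub>R (x - p)"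
      by (simp add: y_def algebra_simps)
    have "y \<in> K"
      using K(1) p x \<tau> by (auto simp: y_def convex_alt)
    then have "y \<in> C"
      using \<tau>(3) by (simp add: C_def l_def y)
    then have "\<tau> * \<bar>f x\<bar> \<le> s"
      using in_cap[of y] \<tau> by (simp add: f_def y abs_mult)
    then have "\<bar>f x\<bar> \<le> 2 * s * l x / \<eta>"
      using \<eta> l by (simp add: \<tau>_def field_simps)
    then show ?thesis using s0 by linarith
  qed
  \<comment> \<open>The slope of the majorant in the height: the first summand serves the points
    with \<open>\<bar>f x\<bar> < t\<close>, through the width estimate, and the second those with
    \<open>l x \<ge> m\<close>.\<close>
  define q where "q = 2 * t * s / \<eta> + R\<^sup>2 / m"
  have q0: "q \<ge> 0"
    using t s0 \<eta> m by (simp add: q_def)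
  define \<kappa> where "\<kappa> = t * s + q * \<eta>"
  show ?thesis
  proof (rule that[of r \<kappa> "t * s - q * (a \<bullet> p)" "q *\<^sub>R a"])
    have A: "t * s - q * (a \<bullet> p) + q *\<^sub>R a \<bullet> x = t * s + q * l x" for x
      by (simp add: l_def inner_diff_right algebra_simps)
    show "a \<bullet> p < r" using \<eta> by (simp add: r_def)
    show "\<kappa> \<ge> 0" using t s0 q0 \<eta> by (simp add: \<kappa>_def)
    show "(w \<bullet> x - w \<bullet> p)\<^sup>2 \<le> t * s - q * (a \<bullet> p) + q *\<^sub>R a \<bullet> x" if x: "x \<in> K" for x
    proof -
      have "(f x)\<^sup>2 \<le> t * s + q * l x"
      proof (cases "\<bar>f x\<bar> \<ge> t")
        case True
        have "(f x)\<^sup>2 \<le> R\<^sup>2 * 1"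
          using R(2)[OF x] by (simp add: abs_le_square_iff[symmetric])
        also have "\<dots> \<le> R\<^sup>2 * (l x / m)"
          using m(1) m(2)[OF x True] by (intro mult_left_mono) (auto simp: field_simps)
        also have "\<dots> \<le> t * s + q * l x"
          using t s0 \<eta> lpos[OF x] by (simp add: q_def algebra_simps)
        finally show ?thesis .
      next
        case False
        have "(f x)\<^sup>2 = \<bar>f x\<bar> * \<bar>f x\<bar>"
          by (simp add: power2_eq_square)
        also have "\<dots> \<le> t * (s + 2 * s * l x / \<eta>)"
          using False width[OF x] by (intro mult_mono) auto
        also have "\<dots> \<le> t * s + q * l x"
          using lpos[OF x] m by (simp add: q_def algebra_simps)
        finally show ?thesis .
      qed
      then show ?thesis
        unfolding A by (simp add: f_def inner_diff_right)
    qed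
    show "t * s - q * (a \<bullet> p) + q *\<^sub>R a \<bullet> x \<le> \<kappa>" if "x \<in> K" "a \<bullet> x < r" for x
      using that q0 unfolding A \<kappa>_def cap by (intro add_left_mono mult_left_mono) auto
    have "\<bar>f x0\<bar> \<le> s"
      using in_cap[of x0] x0 lx0 by (simp add: C_def \<eta>_def)
    then have "e * \<bar>f x0\<bar> \<le> e * s"
      using \<open>e > 0\<close> by (intro mult_left_mono) auto
    then have "\<eta> \<le> 2 * (e * s)"
      using x0(3) by (simp add: \<eta>_def)
    then have "R\<^sup>2 / m * \<eta> \<le> R\<^sup>2 / m * (2 * (e * s))"
      using m by (intro mult_left_mono) auto
    also have "\<dots> = \<delta> * s / 2"
      using m R by (simp add: e_def field_simps)
    finally have "R\<^sup>2 / m * \<eta> \<le> \<delta> * s / 2" .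
    moreover have "\<kappa> = \<delta> * s / 2 + R\<^sup>2 / m * \<eta>"
      using \<eta> by (simp add: \<kappa>_def q_def t_def distrib_right)
    moreover have "u \<le> v / 2 \<Longrightarrow> z = v / 2 + u \<Longrightarrow> z \<le> v" for u v z :: real
      by linarith
    ultimately have "\<kappa> \<le> \<delta> * s"
      by blast
    moreover have "{x\<in>K. a \<bullet> x < r} = C"
      by (auto simp: C_def cap)
    ultimately show "\<kappa> \<le> \<delta> * measure lebesgue ((\<bullet>) w ` {x\<in>K. a \<bullet> x < r})"
      by (simp add: s_def J_def)
  qed
qed

section \<open>Closedness of the set of extreme points in the plane\<close>

lemma eventually_nhds_abs_less:
  fixes f :: "'a::t2_space \<Rightarrow> real"
  assumes "isCont f x" "f x = 0" "e > 0"
  shows "\<forall>\<^sub>F y in nhds x. \<bar>f y\<bar> < e"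
proof -
  have "(f \<longlongrightarrow> f x) (nhds x)"
    using assms(1) by (metis isCont_def tendsto_at_iff_tendsto_nhds)
  from tendstoD[OF this assms(3)] show ?thesis
    by (simp add: dist_norm assms(2))
qed

text \<open>A point \<open>x\<close> inside a segment of \<open>K\<close> with direction
  \<open>d\<close> has a neighbourhood without extreme points. A nearby point of \<open>K\<close>
  lies on the line of the segment or on one side of it; on each side that \<open>K\<close> meets,
  the segment and one point \<open>c\<close> of \<open>K\<close> span a triangle, whose points near
  \<open>x\<close> are midpoints of segments of \<open>K\<close> parallel to
  \<open>d\<close>.\<close>

lemma compact_extreme_points_plane:
  fixes K :: "(real ^ 2) set"
  assumes K: "convex K" "compact K"
  shows "compact (extreme_points K)"
proof -
  have "open (- extreme_points K)"
  proof (rule open_subopen[THEN iffD2], intro ballI)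
    fix x assume "x \<in> - extreme_points K"
    then have nx: "\<not> x extreme_point_of K"
      by (simp add: extreme_points_def)
    show "\<exists>T. open T \<and> x \<in> T \<and> T \<subseteq> - extreme_points K"
    proof (cases "x \<in> K")
      case False
      then show ?thesis
        using compact_imp_closed[OF K(2)]
        by (intro exI[of _ "- K"]) (auto simp: extreme_points_def extreme_point_of_def)
    next
      case True
      then obtain a b where ab: "a \<in> K" "b \<in> K" "x \<in> open_segment a b"
        using nx by (auto simp: extreme_point_of_def)
      then obtain u where u: "a \<noteq> b" "0 < u" "u < 1" "x = (1 - u) *\<^sub>R a + u *\<^sub>R b"
        by (auto simp: in_segment)
      define d where "d = b - a"
      have d: "d \<noteq> 0" using u by (simp add: d_def)
      define \<rho> where "\<rho> = min u (1 - u)"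
      have \<rho>: "\<rho> > 0" using u by (simp add: \<rho>_def)
      have seg: "x + \<tau> *\<^sub>R d \<in> K" if "\<bar>\<tau>\<bar> \<le> \<rho>" for \<tau>
      proof -
        have "x + \<tau> *\<^sub>R d = (1 - (u + \<tau>)) *\<^sub>R a + (u + \<tau>) *\<^sub>R b"
          by (simp add: u(4) d_def algebra_simps)
        moreover have "0 \<le> u + \<tau>" "u + \<tau> \<le> 1"
          using that by (auto simp: \<rho>_def)
        ultimately show ?thesis
          using K(1) ab by (simp add: convex_alt)
      qed
      \<comment> \<open>This is the convex combination of \<open>c\<close>, with weight
        \<open>\<beta>\<close>, and a point of the segment through \<open>x\<close>. Since
        \<open>\<beta> \<le> 1 / 2\<close>, dividing by \<open>1 - \<beta>\<close> at most doubles
        the parameter, which stays within \<open>\<rho>\<close>.\<close>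
      have move: "x + \<alpha> *\<^sub>R d + \<beta> *\<^sub>R (c - x) \<in> K"
        if "\<bar>\<alpha>\<bar> \<le> \<rho> / 2" "0 \<le> \<beta>" "\<beta> \<le> 1 / 2" "c \<in> K" for \<alpha> \<beta> c
      proof -
        have "\<bar>\<alpha> / (1 - \<beta>)\<bar> \<le> \<rho>"
        proof -
          have "\<bar>\<alpha>\<bar> \<le> \<rho> * (1 / 2)" using that by simp
          also have "\<dots> \<le> \<rho> * (1 - \<beta>)" using \<rho> that by (intro mult_left_mono) auto
          finally show ?thesis using that by (simp add: field_simps)
        qed
        then have "(1 - \<beta>) *\<^sub>R (x + (\<alpha> / (1 - \<beta>)) *\<^sub>R d) + \<beta> *\<^sub>R c \<in> K"
          using K(1) seg that by (auto simp: convex_alt)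
        moreover have "(1 - \<beta>) *\<^sub>R (x + (\<alpha> / (1 - \<beta>)) *\<^sub>R d) + \<beta> *\<^sub>R c = x + \<alpha> *\<^sub>R d + \<beta> *\<^sub>R (c - x)"
        proof -
          have e: "(1 - \<beta>) * (\<alpha> / (1 - \<beta>)) = \<alpha>" using that by simp
          show ?thesis
            unfolding scaleR_add_right scaleR_scaleR e by (simp add: algebra_simps)
        qed
        ultimately show ?thesis by simp
      qed
      \<comment> \<open>The bound \<open>\<rho> / 4\<close> leaves room to move by another
        \<open>\<rho> / 4\<close> in both directions along \<open>d\<close> without leaving
        \<open>K\<close>.\<close>
      have not_ext: "\<not> (x + \<alpha> *\<^sub>R d + \<beta> *\<^sub>R (c - x)) extreme_point_of K"
        if "\<bar>\<alpha>\<bar> \<le> \<rho> / 4" "0 \<le> \<beta>" "\<beta> \<le> 1 / 2" "c \<in> K" for \<alpha> \<beta> c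
      proof
        define y where "y = x + \<alpha> *\<^sub>R d + \<beta> *\<^sub>R (c - x)"
        assume "y extreme_point_of K"
        define y1 where "y1 = x + (\<alpha> - \<rho> / 4) *\<^sub>R d + \<beta> *\<^sub>R (c - x)"
        define y2 where "y2 = x + (\<alpha> + \<rho> / 4) *\<^sub>R d + \<beta> *\<^sub>R (c - x)"
        have yK: "y1 \<in> K" "y2 \<in> K"
          unfolding y1_def y2_def using that by (auto intro!: move)
        define e where "e = (\<rho> / 4) *\<^sub>R d"
        have e: "e \<noteq> 0" using \<rho> d by (simp add: e_def)
        have y12: "y1 = y - e" "y2 = y + e"
          by (simp_all add: y_def y1_def y2_def e_def algebra_simps)
        have "y1 + y2 = 2 *\<^sub>R y"
          unfolding y12 by (simp add: scaleR_2)
        then have "y = midpoint y1 y2"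
          by (simp add: midpoint_def)
        moreover have "y2 - y1 = 2 *\<^sub>R e"
          unfolding y12 by (simp add: scaleR_2)
        then have "y1 \<noteq> y2"
          using e by auto
        ultimately have "y \<in> open_segment y1 y2"
          by simp
        then show False
          using \<open>y extreme_point_of K\<close> yK by (auto simp: extreme_point_of_def)
      qed
      define det where "det = (\<lambda>(v :: real ^ 2) (z :: real ^ 2). v $ 1 * z $ 2 - v $ 2 * z $ 1)"
      \<comment> \<open>\<open>s\<close> selects a side of the line through \<open>x\<close> in
        direction \<open>d\<close>; the values 1 and -1 are used. If \<open>K\<close> has a point
        \<open>c\<close> on that side, then \<open>d\<close> and \<open>c - x\<close> form a basis,
        and Cramer's rule gives coordinates that depend continuously on \<open>y\<close> and vanish
        at \<open>x\<close>.\<close>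
      have side: "\<forall>\<^sub>F y in nhds x. y \<in> K \<and> s * det d (y - x) > 0 \<longrightarrow> \<not> y extreme_point_of K" for s :: real
      proof (cases "\<exists>c\<in>K. s * det d (c - x) > 0")
        case False
        then show ?thesis
          by (intro always_eventually) auto
      next
        case True
        then obtain c where c: "c \<in> K" "s * det d (c - x) > 0"
          by auto
        then have D: "det d (c - x) \<noteq> 0" by auto
        define \<gamma> where "\<gamma> = inverse (det d (c - x))"
        define \<alpha> where "\<alpha> = (\<lambda>y. \<gamma> * det (y - x) (c - x))"
        define \<beta> where "\<beta> = (\<lambda>y. \<gamma> * det d (y - x))"
        have rep: "y = x + \<alpha> y *\<^sub>R d + \<beta> y *\<^sub>R (c - x)" for y
        proof -
          have cramer: "det d (c - x) *\<^sub>R (y - x) = det (y - x) (c - x) *\<^sub>R d + det d (y - x) *\<^sub>R (c - x)"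
            unfolding vec_eq_iff forall_2 det_def by (simp add: algebra_simps)
          have "y - x = \<gamma> *\<^sub>R (det d (c - x) *\<^sub>R (y - x))"
            using D by (simp add: \<gamma>_def)
          also have "\<dots> = \<alpha> y *\<^sub>R d + \<beta> y *\<^sub>R (c - x)"
            unfolding cramer by (simp add: scaleR_add_right \<alpha>_def \<beta>_def)
          finally show ?thesis
            by (simp add: algebra_simps)
        qed
        have "isCont \<alpha> x" "isCont \<beta> x"
          unfolding \<alpha>_def \<beta>_def det_def by (intro continuous_intros)+
        moreover have "\<alpha> x = 0" "\<beta> x = 0"
          by (simp_all add: \<alpha>_def \<beta>_def det_def)
        moreover have "\<rho> / 4 > 0" "1 / 2 > (0 :: real)"
          using \<rho> by simp_all
        ultimately have "\<forall>\<^sub>F y in nhds x. \<bar>\<alpha> y\<bar> < \<rho> / 4" "\<forall>\<^sub>F y in nhds x. \<bar>\<beta> y\<bar> < 1 / 2"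
          by (blast intro: eventually_nhds_abs_less)+
        then show ?thesis
        proof eventually_elim
          case (elim y)
          show ?case
          proof (intro impI, elim conjE)
            assume y: "0 < s * det d (y - x)"
            have "\<beta> y = (s * det d (y - x)) / (s * det d (c - x))"
              using c(2) by (cases "s = 0") (simp_all add: \<beta>_def \<gamma>_def field_simps)
            then have "\<beta> y \<ge> 0"
              using y c(2) by (simp only: divide_nonneg_pos less_imp_le)
            then show "\<not> y extreme_point_of K"
              using not_ext[of "\<alpha> y" "\<beta> y" c] elim c(1) rep[of y] by simp
          qed
        qed
      qed
      have line: "\<forall>\<^sub>F y in nhds x. det d (y - x) = 0 \<longrightarrow> \<not> y extreme_point_of K"
      proof -
        define \<alpha> where "\<alpha> = (\<lambda>y. (y - x) \<bullet> d / (d \<bullet> d))"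
        have "isCont \<alpha> x"
          unfolding \<alpha>_def using d by (intro continuous_intros) auto
        moreover have "\<alpha> x = 0"
          by (simp add: \<alpha>_def)
        moreover have "\<rho> / 4 > 0"
          using \<rho> by simp
        ultimately have "\<forall>\<^sub>F y in nhds x. \<bar>\<alpha> y\<bar> < \<rho> / 4"
          by (blast intro: eventually_nhds_abs_less)
        then show ?thesis
        proof eventually_elim
          case (elim y)
          show ?case
          proof
            assume y: "det d (y - x) = 0"
            have dd: "d \<bullet> d = d $ 1 * d $ 1 + d $ 2 * d $ 2" "(y - x) \<bullet> d = (y - x) $ 1 * d $ 1 + (y - x) $ 2 * d $ 2"
              by (simp_all add: inner_vec_def sum_2)
            have col: "(d \<bullet> d) *\<^sub>R (y - x) = ((y - x) \<bullet> d) *\<^sub>R d"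
              unfolding vec_eq_iff forall_2 dd using y unfolding det_def
              by (simp add: algebra_simps) algebra
            have "y - x = (1 / (d \<bullet> d)) *\<^sub>R ((d \<bullet> d) *\<^sub>R (y - x))"
              using d by simp
            also have "\<dots> = \<alpha> y *\<^sub>R d"
              unfolding col by (simp add: \<alpha>_def)
            finally have "y = x + \<alpha> y *\<^sub>R d + 0 *\<^sub>R (x - x)"
              by (simp add: algebra_simps)
            then show "\<not> y extreme_point_of K"
              using not_ext[of "\<alpha> y" 0 x] elim True by simp
          qed
        qed
      qed
      have "\<forall>\<^sub>F y in nhds x. \<not> y extreme_point_of K"
        using side[of 1] side[of "-1"] line
      proof eventually_elim
        case (elim y)
        show ?case
        proof
          assume y: "y extreme_point_of K"
          then have "y \<in> K"
            by (simp add: extreme_point_of_def)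
          then show False
            using elim y by (cases rule: linorder_cases[of "det d (y - x)" 0]) simp_all
        qed
      qed
      then show ?thesis
        unfolding eventually_nhds by (auto simp: extreme_points_def)
    qed
  qed
  then have "closed (extreme_points K)"
    by (simp add: closed_def)
  moreover have "extreme_points K \<subseteq> K"
    by (auto simp: extreme_points_def extreme_point_of_def)
  ultimately show ?thesis
    using compact_Int_closed[OF K(2)] by (metis inf.absorb2)
qed

section \<open>Three caps with private extreme points have no common boundary point\<close>

text \<open>Among \<open>x\<close> and the three \<open>y k\<close> there is an affine dependence. Evaluating it on the functionals
  that cut off the caps excludes all sign patterns except two: a \<open>y k\<close> in the hull of the other points,
  and \<open>x\<close> in the relative interior of the triangle; extremality and the supporting line at \<open>x\<close>
  exclude these.\<close>

lemma no_three_caps: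
  fixes K :: "(real ^ 2) set"
  assumes K: "convex K" and x: "x \<in> K" "x \<notin> interior K"
    and T: "card T = 3" and y: "\<And>k. k \<in> T \<Longrightarrow> y k extreme_point_of K"
    and cap: "\<And>k. k \<in> T \<Longrightarrow> a k \<bullet> x < r k" "\<And>k. k \<in> T \<Longrightarrow> a k \<bullet> y k < r k"
    and priv: "\<And>k l. k \<in> T \<Longrightarrow> l \<in> T \<Longrightarrow> l \<noteq> k \<Longrightarrow> r k \<le> a k \<bullet> y l"
  shows False
proof -
  obtain k1 k2 k3 where T3: "T = {k1, k2, k3}" "k1 \<noteq> k2" "k1 \<noteq> k3" "k2 \<noteq> k3"
    using T card_3_iff by metis
  have yK: "y k \<in> K" if "k \<in> T" for k
    using y[OF that] by (simp add: extreme_point_of_def)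
  have inj: "y k \<noteq> y l" if "k \<in> T" "l \<in> T" "k \<noteq> l" for k l
    using cap(2)[of k] priv[of k l] that by auto
  have yx: "y k \<noteq> x" if "k \<in> T" for k
  proof -
    obtain l where l: "l \<in> T" "l \<noteq> k"
      using T3 by blast
    then show ?thesis
      using cap(1)[of l] priv[of l k] that by fastforce
  qed
  \<comment> \<open>The level \<open>r k\<close> separates \<open>x\<close> and \<open>y k\<close>
    from \<open>y l\<close> and \<open>y m\<close>. With these signs all four terms of the
    dependence, evaluated on \<open>a k\<close> minus \<open>r k\<close>, are nonpositive and one is
    negative, although they sum to zero.\<close>
  have excl: False
    if sum: "c0 + c k1 + c k2 + c k3 = 0" "c0 *\<^sub>R x + c k1 *\<^sub>R y k1 + c k2 *\<^sub>R y k2 + c k3 *\<^sub>R y k3 = 0"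
      and k: "{k, l, m} = T" "k \<noteq> l" "k \<noteq> m" "l \<noteq> m"
      and sgn: "c0 \<ge> 0" "c k \<ge> 0" "c l \<le> 0" "c m \<le> 0" "c0 > 0 \<or> c k > 0" for c0 and c k l m
  proof -
    have kT: "k \<in> T" "l \<in> T" "m \<in> T" using k(1) by auto
    have "c0 *\<^sub>R x + c k *\<^sub>R y k + c l *\<^sub>R y l + c m *\<^sub>R y m = 0 \<and> c0 + c k + c l + c m = 0"
    proof -
      have "c0 + (\<Sum>j\<in>{k, l, m}. c j) = 0" "c0 *\<^sub>R x + (\<Sum>j\<in>{k, l, m}. c j *\<^sub>R y j) = 0"
        unfolding k(1) using sum T3 by (simp_all add: algebra_simps)
      then show ?thesis
        using k(2-4) by (simp add: algebra_simps)
    qed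
    then have lin: "a k \<bullet> (c0 *\<^sub>R x + c k *\<^sub>R y k + c l *\<^sub>R y l + c m *\<^sub>R y m) = 0"
      and s0: "c0 + c k + c l + c m = 0"
      by simp_all
    have "c0 * (a k \<bullet> x - r k) + c k * (a k \<bullet> y k - r k) + c l * (a k \<bullet> y l - r k) + c m * (a k \<bullet> y m - r k)
      = a k \<bullet> (c0 *\<^sub>R x + c k *\<^sub>R y k + c l *\<^sub>R y l + c m *\<^sub>R y m) - r k * (c0 + c k + c l + c m)"
      by (simp add: algebra_simps)
    then have "c0 * (a k \<bullet> x - r k) + c k * (a k \<bullet> y k - r k) + c l * (a k \<bullet> y l - r k) + c m * (a k \<bullet> y m - r k) = 0"
      unfolding lin s0 by simp
    moreover have "c l * (a k \<bullet> y l - r k) \<le> 0" "c m * (a k \<bullet> y m - r k) \<le> 0"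
      using priv[OF kT(1) kT(2)] priv[OF kT(1) kT(3)] k sgn by (auto intro!: mult_nonpos_nonneg)
    moreover have "c0 * (a k \<bullet> x - r k) \<le> 0" "c k * (a k \<bullet> y k - r k) \<le> 0"
      using cap(1)[OF kT(1)] cap(2)[OF kT(1)] sgn by (auto intro!: mult_nonneg_nonpos)
    moreover have "c0 * (a k \<bullet> x - r k) < 0 \<or> c k * (a k \<bullet> y k - r k) < 0"
      using cap(1)[OF kT(1)] cap(2)[OF kT(1)] sgn by (auto intro!: mult_pos_neg)
    ultimately show False by linarith
  qed
  \<comment> \<open>Dividing by \<open>c m\<close> makes \<open>y m\<close> a convex combination of
    the other points, whereas \<open>K\<close> without the extreme point \<open>y m\<close> is still
    convex.\<close>
  have hull: False
    if sum: "c0 + c k + c l = c m" "c0 *\<^sub>R x + c k *\<^sub>R y k + c l *\<^sub>R y l = c m *\<^sub>R y m"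
      and k: "{k, l, m} = T" "k \<noteq> l" "k \<noteq> m" "l \<noteq> m"
      and sgn: "c0 \<ge> 0" "c k > 0" "c l > 0" for c0 and c k l m
  proof -
    have kT: "k \<in> T" "l \<in> T" "m \<in> T" using k(1) by auto
    have cm: "c m > 0" using sum sgn by linarith
    have "convex (K - {y m})"
      using y[OF kT(3)] extreme_point_of_stillconvex[OF K] by blast
    moreover have "{x, y k, y l} \<subseteq> K - {y m}"
      using x(1) yK kT inj[OF kT(1) kT(3)] inj[OF kT(2) kT(3)] yx[OF kT(3)] k by auto
    ultimately have "convex hull {x, y k, y l} \<subseteq> K - {y m}"
      by (rule hull_minimal[rotated])
    moreover have "y m \<in> convex hull {x, y k, y l}"
    proof -
      have "y m = (1 / c m) *\<^sub>R (c m *\<^sub>R y m)" using cm by simp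
      also have "\<dots> = (c0 / c m) *\<^sub>R x + (c k / c m) *\<^sub>R y k + (c l / c m) *\<^sub>R y l"
        unfolding sum(2)[symmetric] by (simp add: scaleR_add_right divide_inverse mult.commute)
      finally have "y m = (c0 / c m) *\<^sub>R x + (c k / c m) *\<^sub>R y k + (c l / c m) *\<^sub>R y l" .
      moreover have "c0 / c m + c k / c m + c l / c m = 1"
        unfolding add_divide_distrib[symmetric] sum(1) using cm by simp
      moreover have "c0 / c m \<ge> 0" "c k / c m \<ge> 0" "c l / c m \<ge> 0"
        using sgn cm by simp_all
      ultimately show ?thesis
        unfolding convex_hull_3 by blast
    qed
    ultimately show False by auto
  qed
  \<comment> \<open>Every other sign pattern falls, up to a permutation of the three indices, under
    \<open>excl\<close> or \<open>hull\<close>. For \<open>c0 = 0\<close> the conclusion is absurd,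
    so this also expresses affine independence of the three \<open>y k\<close>.\<close>
  have indep: "c0 > 0 \<and> c k1 < 0 \<and> c k2 < 0 \<and> c k3 < 0"
    if sum: "c0 + c k1 + c k2 + c k3 = 0" "c0 *\<^sub>R x + c k1 *\<^sub>R y k1 + c k2 *\<^sub>R y k2 + c k3 *\<^sub>R y k3 = 0"
      and c: "c0 \<ge> 0" "c0 \<noteq> 0 \<or> c k1 \<noteq> 0 \<or> c k2 \<noteq> 0 \<or> c k3 \<noteq> 0" for c0 c
  proof (rule ccontr)
    assume neg: "\<not> ?thesis"
    have perm: "{k1, k2, k3} = T" "{k2, k1, k3} = T" "{k3, k1, k2} = T" "{k1, k3, k2} = T" "{k2, k3, k1} = T"
      using T3 by auto
    have "\<not> (c k1 \<ge> 0 \<and> c k2 \<le> 0 \<and> c k3 \<le> 0)"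
      using excl[OF sum perm(1)] T3 c sum(1) by (smt (verit))
    moreover have "\<not> (c k2 \<ge> 0 \<and> c k1 \<le> 0 \<and> c k3 \<le> 0)"
      using excl[OF sum perm(2)] T3 c sum(1) by (smt (verit))
    moreover have "\<not> (c k3 \<ge> 0 \<and> c k1 \<le> 0 \<and> c k2 \<le> 0)"
      using excl[OF sum perm(3)] T3 c sum(1) by (smt (verit))
    moreover have "\<not> (c k1 > 0 \<and> c k2 > 0)"
    proof
      assume "c k1 > 0 \<and> c k2 > 0"
      then show False
        using hull[of c0 "c(k3 := - c k3)" k1 k2 k3] T3 c sum
        by (simp add: algebra_simps eq_neg_iff_add_eq_0)
    qed
    moreover have "\<not> (c k1 > 0 \<and> c k3 > 0)"
    proof
      assume "c k1 > 0 \<and> c k3 > 0"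
      then show False
        using hull[of c0 "c(k2 := - c k2)" k1 k3 k2] T3 c sum perm(4)
        by (simp add: algebra_simps eq_neg_iff_add_eq_0)
    qed
    moreover have "\<not> (c k2 > 0 \<and> c k3 > 0)"
    proof
      assume "c k2 > 0 \<and> c k3 > 0"
      then show False
        using hull[of c0 "c(k1 := - c k1)" k2 k3 k1] T3 c sum perm(5)
        by (simp add: algebra_simps eq_neg_iff_add_eq_0)
    qed
    ultimately show False
      using neg c sum(1) by linarith
  qed
  have distinct: "y k1 \<noteq> y k2" "y k1 \<noteq> y k3" "y k2 \<noteq> y k3" "x \<noteq> y k1" "x \<noteq> y k2" "x \<noteq> y k3"
    using inj[of k1 k2] inj[of k1 k3] inj[of k2 k3] yx[of k1] yx[of k2] yx[of k3] T3 by auto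
  then have "card {x, y k1, y k2, y k3} = 4"
    by simp
  then have "affine_dependent {x, y k1, y k2, y k3}"
    by (intro affine_dependent_biggerset) simp_all
  then obtain U where U: "sum U {x, y k1, y k2, y k3} = 0" "\<exists>v\<in>{x, y k1, y k2, y k3}. U v \<noteq> 0"
    "(\<Sum>v\<in>{x, y k1, y k2, y k3}. U v *\<^sub>R v) = 0"
    using affine_dependent_explicit_finite[of "{x, y k1, y k2, y k3}"] by auto
  have U1: "U x + U (y k1) + U (y k2) + U (y k3) = 0"
    "U x *\<^sub>R x + U (y k1) *\<^sub>R y k1 + U (y k2) *\<^sub>R y k2 + U (y k3) *\<^sub>R y k3 = 0"
    using U(1,3) distinct by (simp_all add: add.assoc)
  obtain c0 c where c: "c0 + c k1 + c k2 + c k3 = 0" "c0 *\<^sub>R x + c k1 *\<^sub>R y k1 + c k2 *\<^sub>R y k2 + c k3 *\<^sub>R y k3 = 0"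
    "c0 \<ge> 0" "c0 \<noteq> 0 \<or> c k1 \<noteq> 0 \<or> c k2 \<noteq> 0 \<or> c k3 \<noteq> 0"
  proof (cases "U x \<ge> 0")
    case True
    then show ?thesis
      using that[of "U x" "\<lambda>k. U (y k)"] U1 U(2) by auto
  next
    case False
    have "- U x + - U (y k1) + - U (y k2) + - U (y k3) = 0"
      using U1(1) by linarith
    moreover have "- U x *\<^sub>R x + - U (y k1) *\<^sub>R y k1 + - U (y k2) *\<^sub>R y k2 + - U (y k3) *\<^sub>R y k3
        = - (U x *\<^sub>R x + U (y k1) *\<^sub>R y k1 + U (y k2) *\<^sub>R y k2 + U (y k3) *\<^sub>R y k3)"
      by (simp add: algebra_simps)
    ultimately show ?thesis
      using that[of "- U x" "\<lambda>k. - U (y k)"] U1(2) False by simp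
  qed
  have sgn: "c0 > 0" "c k1 < 0" "c k2 < 0" "c k3 < 0"
    using indep[OF c] by auto
  \<comment> \<open>By the signs just found, \<open>x\<close> is a combination of the three
    \<open>y k\<close> with positive weights. A functional minimal at \<open>x\<close> is then
    constant on them, so they are collinear.\<close>
  obtain b where b: "b \<noteq> 0" "\<And>z. z \<in> K \<Longrightarrow> b \<bullet> x \<le> b \<bullet> z"
    using supporting_functional[OF K x] by metis
  have "c k1 * (b \<bullet> y k1 - b \<bullet> x) + c k2 * (b \<bullet> y k2 - b \<bullet> x) + c k3 * (b \<bullet> y k3 - b \<bullet> x)
      = b \<bullet> (c0 *\<^sub>R x + c k1 *\<^sub>R y k1 + c k2 *\<^sub>R y k2 + c k3 *\<^sub>R y k3) - (b \<bullet> x) * (c0 + c k1 + c k2 + c k3)"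
    by (simp add: algebra_simps)
  then have "c k1 * (b \<bullet> y k1 - b \<bullet> x) + c k2 * (b \<bullet> y k2 - b \<bullet> x) + c k3 * (b \<bullet> y k3 - b \<bullet> x) = 0"
    unfolding c(1,2) by simp
  moreover have nonpos: "c k1 * (b \<bullet> y k1 - b \<bullet> x) \<le> 0" "c k2 * (b \<bullet> y k2 - b \<bullet> x) \<le> 0" "c k3 * (b \<bullet> y k3 - b \<bullet> x) \<le> 0"
    using sgn b(2)[OF yK] T3 by (auto intro!: mult_nonpos_nonneg)
  ultimately have "c k1 * (b \<bullet> y k1 - b \<bullet> x) = 0" "c k2 * (b \<bullet> y k2 - b \<bullet> x) = 0" "c k3 * (b \<bullet> y k3 - b \<bullet> x) = 0"
    by linarith+
  then have const: "b \<bullet> (y k1 - y k3) = 0" "b \<bullet> (y k2 - y k3) = 0"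
    using sgn by (auto simp: inner_diff_right)
  define v1 where "v1 = y k1 - y k3"
  define v2 where "v2 = y k2 - y k3"
  obtain t1 t2 where t: "t1 *\<^sub>R v1 + t2 *\<^sub>R v2 = 0" "t1 \<noteq> 0 \<or> t2 \<noteq> 0"
  proof -
    \<comment> \<open>Rotating \<open>b\<close> by a right angle gives a vector that spans the
      kernel of \<open>b\<close>.\<close>
    define w where "w = (\<chi> n. if n = 1 then - b $ 2 else b $ 1 :: real ^ 2)"
    have par: "(w \<bullet> w) *\<^sub>R v = (w \<bullet> v) *\<^sub>R w" if "b \<bullet> v = 0" for v :: "real ^ 2"
      using that unfolding vec_eq_iff forall_2 inner_vec_def sum_2 w_def
      by (simp add: algebra_simps) algebra
    have w: "w \<bullet> w \<noteq> 0"
      using b(1) by (auto simp: w_def vec_eq_iff forall_2)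
    have v1: "v1 \<noteq> 0"
      using inj[of k1 k3] T3 by (simp add: v1_def)
    have "(w \<bullet> v2) *\<^sub>R v1 + (- (w \<bullet> v1)) *\<^sub>R v2 = 0"
    proof -
      have "(w \<bullet> w) *\<^sub>R ((w \<bullet> v2) *\<^sub>R v1 + (- (w \<bullet> v1)) *\<^sub>R v2)
          = (w \<bullet> v2) *\<^sub>R ((w \<bullet> w) *\<^sub>R v1) - (w \<bullet> v1) *\<^sub>R ((w \<bullet> w) *\<^sub>R v2)"
        by (simp add: algebra_simps)
      also have "\<dots> = 0"
        using par[of v1] par[of v2] const by (simp add: v1_def v2_def)
      finally show ?thesis using w by simp
    qed
    moreover have "w \<bullet> v1 \<noteq> 0"
      using par[of v1] const(1) v1 w by (auto simp: v1_def)
    ultimately show ?thesis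
      using that[of "w \<bullet> v2" "- (w \<bullet> v1)"] by simp
  qed
  \<comment> \<open>A nontrivial affine dependence with weight zero at \<open>x\<close>, which
    \<open>indep\<close> rules out.\<close>
  define c' where "c' = (\<lambda>k. if k = k1 then t1 else if k = k2 then t2 else - (t1 + t2))"
  have "0 *\<^sub>R x + c' k1 *\<^sub>R y k1 + c' k2 *\<^sub>R y k2 + c' k3 *\<^sub>R y k3 = t1 *\<^sub>R v1 + t2 *\<^sub>R v2"
    using T3 by (simp add: c'_def v1_def v2_def algebra_simps)
  then have "(0::real) < 0"
    using indep[of 0 c'] t T3 by (auto simp: c'_def)
  then show False by simp
qed

section \<open>Countability of the exceptional extreme points\<close>

lemma open_segment_on_line:
  fixes p q z :: "real ^ 2"
  assumes ij: "i \<noteq> j" and a: "a $ j \<noteq> 0" and line: "a \<bullet> p = a \<bullet> z" "a \<bullet> q = a \<bullet> z"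
    and \<tau>: "\<tau> * p $ i < \<tau> * z $ i" "\<tau> * z $ i < \<tau> * q $ i"
  shows "z \<in> open_segment p q"
proof -
  \<comment> \<open>The factor \<open>\<tau>\<close> lets one statement serve both orders of the
    abscissae and cancels here. As \<open>a $ j\<close> is nonzero, the line is a graph over
    coordinate \<open>i\<close>, so the parameter of \<open>z\<close> can be read off from that
    coordinate.\<close>
  define u where "u = (\<tau> * z $ i - \<tau> * p $ i) / (\<tau> * q $ i - \<tau> * p $ i)"
  have \<tau>0: "\<tau> \<noteq> 0" and ne: "q $ i - p $ i \<noteq> 0"
    using \<tau> by auto
  have u: "0 < u" "u < 1"
    using \<tau> by (simp_all add: u_def)
  have "u = \<tau> * (z $ i - p $ i) / (\<tau> * (q $ i - p $ i))"
    by (simp add: u_def right_diff_distrib)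
  also have "\<dots> = (z $ i - p $ i) / (q $ i - p $ i)"
    using \<tau>0 by simp
  finally have "u * (q $ i - p $ i) = z $ i - p $ i"
    using ne by simp
  then have zi: "z $ i = (1 - u) * p $ i + u * q $ i"
    by (simp add: algebra_simps)
  have "a $ j * z $ j = a \<bullet> z - a $ i * z $ i"
    by (simp add: inner_plane[OF ij])
  also have "\<dots> = (1 - u) * (a \<bullet> p - a $ i * p $ i) + u * (a \<bullet> q - a $ i * q $ i)"
    unfolding line zi by (simp add: algebra_simps)
  also have "\<dots> = a $ j * ((1 - u) * p $ j + u * q $ j)"
    by (simp add: inner_plane[OF ij] algebra_simps)
  finally have "z = (1 - u) *\<^sub>R p + u *\<^sub>R q"
    using a zi by (simp add: eq_plane[OF ij])
  moreover have "p \<noteq> q"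
    using ne by auto
  ultimately show ?thesis
    unfolding in_segment using u by blast
qed

text \<open>There are at most two such points, the highest and the lowest: one strictly between two
  others would lie in an open segment.\<close>

lemma countable_extreme_points_on_line:
  fixes K :: "(real ^ 2) set"
  shows "countable {p. p extreme_point_of K \<and> p $ i = t}"
proof -
  obtain j :: 2 where ij: "i \<noteq> j"
    using exhaust_2[of i] by (metis zero_neq_one)
  define S where "S = {p. p extreme_point_of K \<and> p $ i = t}"
  define up where "up = {p \<in> S. \<forall>q\<in>S. q $ j \<le> p $ j}"
  define lo where "lo = {p \<in> S. \<forall>q\<in>S. p $ j \<le> q $ j}"
  have "S \<subseteq> up \<union> lo"
  proof
    fix p assume p: "p \<in> S"
    show "p \<in> up \<union> lo"
    proof (rule ccontr)
      assume "p \<notin> up \<union> lo"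
      then obtain q q' where q: "q \<in> S" "p $ j < q $ j" "q' \<in> S" "q' $ j < p $ j"
        using p by (auto simp: up_def lo_def not_le)
      have "axis i 1 \<bullet> q' = axis i 1 \<bullet> p" "axis i 1 \<bullet> q = axis i 1 \<bullet> p"
        using p q by (simp_all add: S_def inner_axis')
      then have "p \<in> open_segment q' q"
        using open_segment_on_line[of j i "axis i 1" q' p q 1] ij q by simp
      then show False
        using p q by (auto simp: S_def extreme_point_of_def)
    qed
  qed
  moreover have "countable up"
    by (rule countableI[of "\<lambda>_. 0"]) (auto simp: inj_on_def up_def S_def eq_plane[OF ij] intro: order_antisym)
  moreover have "countable lo"
    by (rule countableI[of "\<lambda>_. 0"]) (auto simp: inj_on_def lo_def S_def eq_plane[OF ij] intro: order_antisym)
  ultimately show ?thesis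
    unfolding S_def[symmetric] by (meson countable_Un countable_subset)
qed

text \<open>A corner is exposed by an open interval of slopes, hence by a rational slope, which determines it.
  A non-exposed extreme point is the end of a flat part of the boundary, and is determined by a rational
  abscissa inside that flat part together with the side on which it lies.\<close>

lemma countable_not_flat_exposed:
  fixes K :: "(real ^ 2) set"
  assumes K: "convex K"
  shows "countable {p. p extreme_point_of K \<and>
    \<not> (\<exists>a. (\<forall>x\<in>K. x \<noteq> p \<longrightarrow> a \<bullet> p < a \<bullet> x) \<and>
            (\<forall>e>0. \<exists>x\<in>K. x \<noteq> p \<and> a \<bullet> (x - p) < e * \<bar>x $ i - p $ i\<bar>))}"
    (is "countable ?bad")
proof -
  obtain j :: 2 where ij: "i \<noteq> j"
    using exhaust_2[of i] by (metis zero_neq_one)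
  \<comment> \<open>Normals are scaled so that their \<open>j\<close> component \<open>s\<close> is
    1 or -1; the slope \<open>m\<close> is then the only continuous parameter.\<close>
  define av where "av = (\<lambda>s m. \<chi> n. if n = j then s else m :: real ^ 2)"
  have av: "av s m \<bullet> v = m * v $ i + s * v $ j" for s m v
    using ij by (simp add: inner_plane[OF ij] av_def)
  \<comment> \<open>The extreme points of largest and smallest abscissa are set aside, since only
    there can a supporting functional have a vanishing \<open>j\<close> component.\<close>
  define M1 where "M1 = {p. p extreme_point_of K \<and> (\<forall>x\<in>K. x $ i \<le> p $ i)}"
  define M2 where "M2 = {p. p extreme_point_of K \<and> (\<forall>x\<in>K. p $ i \<le> x $ i)}"
  define E1 where "E1 = (\<lambda>s. {p\<in>K. \<exists>q::rat. \<forall>x\<in>K. x \<noteq> p \<longrightarrow> av s (of_rat q) \<bullet> p < av s (of_rat q) \<bullet> x})"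
  \<comment> \<open>The supporting functional of slope \<open>m\<close> is minimal at
    \<open>q\<close> as well as at \<open>p\<close>, so the boundary is flat between them;
    \<open>r\<close> is a rational abscissa strictly inside. For \<open>\<tau> = 1\<close> the point
    \<open>q\<close> lies to the right of \<open>p\<close>, for \<open>\<tau> = -1\<close> to the
    left.\<close>
  define F where "F = (\<lambda>s \<tau> p r m q. q \<in> K \<and> (\<forall>x\<in>K. av s m \<bullet> p \<le> av s m \<bullet> x) \<and>
      av s m \<bullet> q = av s m \<bullet> p \<and> \<tau> * p $ i < \<tau> * of_rat r \<and> \<tau> * of_rat r < \<tau> * q $ i)"
  define E2 where "E2 = (\<lambda>s \<tau>. {p. p extreme_point_of K \<and> (\<exists>(r::rat) m q. F s \<tau> p r m q)})"
  have M1: "countable M1"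
  proof (cases "M1 = {}")
    case False
    then obtain p0 where "p0 \<in> M1" by auto
    then have "M1 \<subseteq> {p. p extreme_point_of K \<and> p $ i = p0 $ i}"
      by (auto simp: M1_def extreme_point_of_def intro: order_antisym)
    then show ?thesis
      using countable_extreme_points_on_line countable_subset by blast
  qed simp
  have M2: "countable M2"
  proof (cases "M2 = {}")
    case False
    then obtain p0 where "p0 \<in> M2" by auto
    then have "M2 \<subseteq> {p. p extreme_point_of K \<and> p $ i = p0 $ i}"
      by (auto simp: M2_def extreme_point_of_def intro: order_antisym)
    then show ?thesis
      using countable_extreme_points_on_line countable_subset by blast
  qed simp
  have E1: "countable (E1 s)" for s
  proof -
    define g where "g = (\<lambda>p. SOME q::rat. \<forall>x\<in>K. x \<noteq> p \<longrightarrow> av s (of_rat q) \<bullet> p < av s (of_rat q) \<bullet> x)"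
    have g: "\<forall>x\<in>K. x \<noteq> p \<longrightarrow> av s (of_rat (g p)) \<bullet> p < av s (of_rat (g p)) \<bullet> x" if "p \<in> E1 s" for p
      unfolding g_def by (rule someI_ex) (use that in \<open>simp add: E1_def\<close>)
    have "inj_on g (E1 s)"
    proof (rule inj_onI, rule ccontr)
      fix p p' assume p: "p \<in> E1 s" "p' \<in> E1 s" "g p = g p'" "p \<noteq> p'"
      then have "p \<in> K" "p' \<in> K" by (auto simp: E1_def)
      then show False
        using g[OF p(1)] g[OF p(2)] p(3,4) by force
    qed
    then show ?thesis
      by (rule countableI')
  qed
  have E2: "countable (E2 s \<tau>)" if s: "s \<noteq> 0" for s \<tau>
  proof -
    have avj: "av s m $ j \<noteq> 0" for m
      using s by (simp add: av_def)
    define g where "g = (\<lambda>p. SOME r. \<exists>m q. F s \<tau> p r m q)"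
    have g: "\<exists>m q. F s \<tau> p (g p) m q" if "p \<in> E2 s \<tau>" for p
      unfolding g_def by (rule someI_ex) (use that in \<open>simp add: E2_def\<close>)
    have "inj_on g (E2 s \<tau>)"
    proof (rule inj_onI)
      fix p1 p2 assume p: "p1 \<in> E2 s \<tau>" "p2 \<in> E2 s \<tau>" "g p1 = g p2"
      define r where "r = (of_rat (g p1) :: real)"
      obtain m1 q1 where F1: "q1 \<in> K" "\<And>x. x \<in> K \<Longrightarrow> av s m1 \<bullet> p1 \<le> av s m1 \<bullet> x"
        "av s m1 \<bullet> q1 = av s m1 \<bullet> p1" "\<tau> * p1 $ i < \<tau> * r" "\<tau> * r < \<tau> * q1 $ i"
        using g[OF p(1)] unfolding F_def r_def by blast
      obtain m2 q2 where F2: "q2 \<in> K" "\<And>x. x \<in> K \<Longrightarrow> av s m2 \<bullet> p2 \<le> av s m2 \<bullet> x"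
        "av s m2 \<bullet> q2 = av s m2 \<bullet> p2" "\<tau> * p2 $ i < \<tau> * r" "\<tau> * r < \<tau> * q2 $ i"
        using g[OF p(2)] unfolding F_def r_def p(3) by blast
      have ext: "p1 extreme_point_of K" "p2 extreme_point_of K"
        using p by (auto simp: E2_def)
      then have pK: "p1 \<in> K" "p2 \<in> K"
        by (auto simp: extreme_point_of_def)
      have crossing: "\<exists>z u. 0 < u \<and> u < 1 \<and> z = (1 - u) *\<^sub>R p + u *\<^sub>R q \<and> z $ i = r"
        if "\<tau> * p $ i < \<tau> * r" "\<tau> * r < \<tau> * q $ i" for p q :: "real ^ 2"
      proof -
        define u where "u = (\<tau> * r - \<tau> * p $ i) / (\<tau> * q $ i - \<tau> * p $ i)"
        have \<tau>0: "\<tau> \<noteq> 0" and ne: "q $ i - p $ i \<noteq> 0"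
          using that by auto
        have "u = \<tau> * (r - p $ i) / (\<tau> * (q $ i - p $ i))"
          by (simp add: u_def right_diff_distrib)
        also have "\<dots> = (r - p $ i) / (q $ i - p $ i)"
          using \<tau>0 by simp
        finally have "u * (q $ i - p $ i) = r - p $ i"
          using ne by simp
        then have "((1 - u) *\<^sub>R p + u *\<^sub>R q) $ i = r"
          by (simp add: algebra_simps)
        moreover have "0 < u" "u < 1"
          using that by (simp_all add: u_def)
        ultimately show ?thesis by blast
      qed
      obtain z1 u1 where z1: "0 < u1" "u1 < 1" "z1 = (1 - u1) *\<^sub>R p1 + u1 *\<^sub>R q1" "z1 $ i = r"
        using crossing[OF F1(4,5)] by blast
      obtain z2 u2 where z2: "0 < u2" "u2 < 1" "z2 = (1 - u2) *\<^sub>R p2 + u2 *\<^sub>R q2" "z2 $ i = r"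
        using crossing[OF F2(4,5)] by blast
      have zK: "z1 \<in> K" "z2 \<in> K"
        unfolding z1(3) z2(3) using K pK F1(1) F2(1) z1(1,2) z2(1,2) by (simp_all add: convex_alt)
      have face: "av s m1 \<bullet> z1 = av s m1 \<bullet> p1" "av s m2 \<bullet> z2 = av s m2 \<bullet> p2"
        unfolding z1(3) z2(3) inner_add_right inner_scaleR_right F1(3) F2(3) by (simp_all add: algebra_simps)
      \<comment> \<open>Each functional is minimal at its own point. Both points have abscissa
        \<open>r\<close>, so the two inequalities compare only the \<open>j\<close> coordinates,
        with the same factor \<open>s\<close> and in opposite directions.\<close>
      have "av s m1 \<bullet> z1 \<le> av s m1 \<bullet> z2" "av s m2 \<bullet> z2 \<le> av s m2 \<bullet> z1"
        unfolding face using F1(2) F2(2) zK by blast+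
      then have "s * z1 $ j = s * z2 $ j"
        using z1(4) z2(4) by (auto simp: av)
      then have "z1 = z2"
        using s z1(4) z2(4) by (simp add: eq_plane[OF ij])
      then have "av s m1 \<bullet> z1 = (1 - u2) * (av s m1 \<bullet> p2) + u2 * (av s m1 \<bullet> q2)"
        using z2(3) by (simp add: inner_add_right)
      then have "(1 - u2) * (av s m1 \<bullet> p2 - av s m1 \<bullet> p1) + u2 * (av s m1 \<bullet> q2 - av s m1 \<bullet> p1) = 0"
        using face(1) by (simp add: algebra_simps)
      moreover have "(1 - u2) * (av s m1 \<bullet> p2 - av s m1 \<bullet> p1) \<ge> 0" "u2 * (av s m1 \<bullet> q2 - av s m1 \<bullet> p1) \<ge> 0"
        using F1(2)[OF pK(2)] F1(2)[OF F2(1)] z2(1,2) by simp_all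
      ultimately have "(1 - u2) * (av s m1 \<bullet> p2 - av s m1 \<bullet> p1) = 0" "u2 * (av s m1 \<bullet> q2 - av s m1 \<bullet> p1) = 0"
        by linarith+
      then have line: "av s m1 \<bullet> p2 = av s m1 \<bullet> p1" "av s m1 \<bullet> q2 = av s m1 \<bullet> p1"
        using z2(1,2) by simp_all
      \<comment> \<open>Both flat pieces now lie on one line. If the abscissae differ, the one of
        \<open>p1\<close> and \<open>p2\<close> nearer to \<open>r\<close> is interior to the flat
        piece of the other, against extremality.\<close>
      consider "\<tau> * p1 $ i < \<tau> * p2 $ i" | "\<tau> * p2 $ i < \<tau> * p1 $ i" | "\<tau> * p1 $ i = \<tau> * p2 $ i"
        by linarith
      then show "p1 = p2"
      proof cases
        case 1
        then have "p2 \<in> open_segment p1 q1"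
          using F1(3,5) F2(4) line by (intro open_segment_on_line[OF ij avj[of m1], where \<tau> = \<tau>]) auto
        then show ?thesis
          using ext(2) pK(1) F1(1) by (auto simp: extreme_point_of_def)
      next
        case 2
        then have "p1 \<in> open_segment p2 q2"
          using F2(5) F1(4) line by (intro open_segment_on_line[OF ij avj[of m1], where \<tau> = \<tau>]) auto
        then show ?thesis
          using ext(1) pK(2) F2(1) by (auto simp: extreme_point_of_def)
      next
        case 3
        then have "p1 $ i = p2 $ i"
          using F1(4,5) by (cases "\<tau> = 0") auto
        then show ?thesis
          using line(1) s by (simp add: av eq_plane[OF ij])
      qed
    qed
    then show ?thesis
      by (rule countableI')
  qed
  have "?bad \<subseteq> M1 \<union> M2 \<union> (\<Union>s\<in>{1,-1}. E1 s) \<union> (\<Union>s\<in>{1,-1}. \<Union>\<tau>\<in>{1,-1}. E2 s \<tau>)"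
  proof
    fix p assume p: "p \<in> ?bad"
    then have ext: "p extreme_point_of K"
      by simp
    then have pK: "p \<in> K"
      by (simp add: extreme_point_of_def)
    show "p \<in> M1 \<union> M2 \<union> (\<Union>s\<in>{1,-1}. E1 s) \<union> (\<Union>s\<in>{1,-1}. \<Union>\<tau>\<in>{1,-1}. E2 s \<tau>)"
    proof (cases "p \<in> M1 \<union> M2")
      case False
      obtain a where a: "a \<noteq> 0" "\<And>y. y \<in> K \<Longrightarrow> a \<bullet> p \<le> a \<bullet> y"
        using supporting_functional[OF K pK extreme_point_not_in_interior[OF ext]] by metis
      have aj: "a $ j \<noteq> 0"
      proof
        assume 0: "a $ j = 0"
        then have ai: "a $ i \<noteq> 0"
          using a(1) eq_plane[OF ij, of a 0] by auto
        have le: "a $ i * p $ i \<le> a $ i * y $ i" if "y \<in> K" for y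
          using a(2)[OF that] 0 by (simp add: inner_plane[OF ij])
        show False
        proof (cases "a $ i > 0")
          case True
          then have "p \<in> M2"
            using le ext by (auto simp: M2_def)
          then show False using False by blast
        next
          case neg: False
          then have "p \<in> M1"
            using le ext ai by (auto simp: M1_def mult_le_cancel_left)
          then show False using False by blast
        qed
      qed
      define s where "s = sgn (a $ j)"
      define m where "m = a $ i / \<bar>a $ j\<bar>"
      have s: "s \<in> {1, -1}"
        using aj by (auto simp: s_def sgn_if)
      have "av s m = (1 / \<bar>a $ j\<bar>) *\<^sub>R a"
        using ij by (simp add: eq_plane[OF ij] av_def s_def m_def sgn_div_norm divide_inverse mult.commute)
      then have supp: "av s m \<bullet> p \<le> av s m \<bullet> x" if "x \<in> K" for x
        using a(2)[OF that] aj by (simp add: divide_right_mono)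
      show ?thesis
      proof (cases "\<exists>q\<in>K. q \<noteq> p \<and> av s m \<bullet> q = av s m \<bullet> p")
        case True
        then obtain q where q: "q \<in> K" "q \<noteq> p" "av s m \<bullet> q = av s m \<bullet> p"
          by blast
        have "q $ i \<noteq> p $ i"
          using q(2,3) s by (auto simp: av eq_plane[OF ij])
        then consider "p $ i < q $ i" | "q $ i < p $ i"
          by linarith
        then have "\<exists>\<tau>\<in>{1,-1}. \<exists>r. F s \<tau> p r m q"
        proof cases
          case 1
          then obtain r where "p $ i < of_rat r" "of_rat r < q $ i"
            using of_rat_dense by blast
          then have "F s 1 p r m q"
            using q supp by (simp add: F_def)
          then show ?thesis by blast
        next
          case 2
          then obtain r where "q $ i < of_rat r" "of_rat r < p $ i"
            using of_rat_dense by blast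
          then have "F s (-1) p r m q"
            using q supp by (simp add: F_def)
          then show ?thesis by blast
        qed
        then have "\<exists>\<tau>\<in>{1,-1}. p \<in> E2 s \<tau>"
          using ext unfolding E2_def by blast
        then show ?thesis
          using s by blast
      next
        case False
        then have exposed: "\<forall>x\<in>K. x \<noteq> p \<longrightarrow> av s m \<bullet> p < av s m \<bullet> x"
          using supp by (force simp: less_le)
        \<comment> \<open>An exposed point that is not flat has a linear lower bound at
          \<open>p\<close>. Changing the slope by less than \<open>e\<close> preserves strict
          minimality, which makes room for a rational slope.\<close>
        then obtain e where e: "e > 0" "\<And>x. x \<in> K \<Longrightarrow> x \<noteq> p \<Longrightarrow> e * \<bar>x $ i - p $ i\<bar> \<le> av s m \<bullet> (x - p)"
          using p by (force simp: not_less)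
        obtain q where q: "m < of_rat q" "of_rat q < m + e"
          using of_rat_dense[of m "m + e"] e(1) by auto
        have "av s (of_rat q) \<bullet> p < av s (of_rat q) \<bullet> x" if x: "x \<in> K" "x \<noteq> p" for x
        proof -
          have "av s (of_rat q) \<bullet> x - av s (of_rat q) \<bullet> p = av s m \<bullet> (x - p) + (of_rat q - m) * (x $ i - p $ i)"
            by (simp add: av algebra_simps)
          moreover have "av s m \<bullet> (x - p) + (of_rat q - m) * (x $ i - p $ i) > 0"
          proof (cases "x $ i = p $ i")
            case True
            then show ?thesis
              using exposed x by (simp add: inner_diff_right)
          next
            case False
            have "\<bar>(of_rat q - m) * (x $ i - p $ i)\<bar> < e * \<bar>x $ i - p $ i\<bar>"
              unfolding abs_mult using q False by (intro mult_strict_right_mono) auto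
            then show ?thesis
              using e(2)[OF x] by linarith
          qed
          ultimately show ?thesis by linarith
        qed
        then have "p \<in> E1 s"
          using pK by (auto simp: E1_def)
        then show ?thesis
          using s by blast
      qed
    qed blast
  qed
  moreover have "countable (M1 \<union> M2 \<union> (\<Union>s\<in>{1,-1}. E1 s) \<union> (\<Union>s\<in>{1,-1}. \<Union>\<tau>\<in>{1,-1}. E2 s \<tau>))"
    using M1 M2 E1 E2 by auto
  ultimately show ?thesis
    by (rule countable_subset)
qed

section \<open>Total width of the caps and the resulting covers\<close>

text \<open>A cap meeting a vertical chord of \<open>K\<close> contains an endpoint of that chord, and each of the two
  endpoints lies in at most two caps.\<close>

lemma sum_cap_widths:
  fixes K :: "(real ^ 2) set"
  assumes K: "convex K" "compact K" and G: "finite G"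
    and y: "\<And>p. p \<in> G \<Longrightarrow> y p extreme_point_of K" "\<And>p. p \<in> G \<Longrightarrow> a p \<bullet> y p < r p"
    and priv: "\<And>p q. p \<in> G \<Longrightarrow> q \<in> G \<Longrightarrow> q \<noteq> p \<Longrightarrow> r p \<le> a p \<bullet> y q"
  shows "(\<Sum>p\<in>G. measure lebesgue ((\<bullet>) (axis i 1) ` {x\<in>K. a p \<bullet> x < r p}))
    \<le> 4 * measure lebesgue ((\<bullet>) (axis i 1) ` K)"
proof -
  obtain j :: 2 where ij: "i \<noteq> j"
    using exhaust_2[of i] by (metis zero_neq_one)
  define w where "w = (axis i 1 :: real ^ 2)"
  have w: "w \<bullet> x = x $ i" for x
    by (simp add: w_def inner_axis')
  define J where "J = (\<lambda>p. (\<bullet>) w ` {x\<in>K. a p \<bullet> x < r p})"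
  define L where "L = (\<bullet>) w ` K"
  have linear: "linear ((\<bullet>) w)"
    by (intro bounded_linear.linear bounded_linear_inner_right)
  have "bounded L"
    unfolding L_def using K(2) by (intro compact_imp_bounded compact_continuous_image continuous_intros)
  moreover have "convex L"
    unfolding L_def by (intro convex_linear_image linear K)
  ultimately have Lm: "L \<in> lmeasurable"
    by (intro measurable_convex)
  have Jm: "J p \<in> lmeasurable" for p
  proof (rule measurable_convex)
    have "{x\<in>K. a p \<bullet> x < r p} = K \<inter> {x. a p \<bullet> x < r p}"
      by auto
    then show "convex (J p)"
      unfolding J_def using K(1) by (simp add: convex_linear_image linear convex_Int convex_halfspace_lt)
    show "bounded (J p)"
      by (rule bounded_subset[OF \<open>bounded L\<close>]) (auto simp: J_def L_def)
  qed
  have at_most_two: "card {p\<in>G. a p \<bullet> x < r p} \<le> 2" if x: "x \<in> K" "x \<notin> interior K" for x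
  proof (rule ccontr)
    assume "\<not> ?thesis"
    then obtain T where T: "T \<subseteq> {p\<in>G. a p \<bullet> x < r p}" "card T = 3"
      using obtain_subset_with_card_n[of 3 "{p\<in>G. a p \<bullet> x < r p}"] by auto
    show False
      by (rule no_three_caps[where T = T and y = y and a = a and r = r, OF K(1) x T(2)])
        ((use T(1) y priv in blast)+)
  qed
  have overlap: "(\<Sum>p\<in>G. indicator (J p) t) \<le> 4 * (indicator L t :: real)" for t
  proof (cases "t \<in> L")
    case False
    then have "(\<Sum>p\<in>G. indicator (J p) t) = (0::real)"
      by (intro sum.neutral) (auto simp: J_def L_def indicator_def)
    then show ?thesis by simp
  next
    case True
    define C where "C = {x\<in>K. x $ i = t}"
    have "C = K \<inter> {x. w \<bullet> x = t}"
      by (auto simp: C_def w)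
    then have "compact C"
      using K(2) by (simp add: compact_Int_closed closed_hyperplane)
    moreover have "C \<noteq> {}"
      using True by (auto simp: C_def L_def w)
    moreover have "continuous_on C (\<lambda>x. x $ j)"
      by (intro continuous_intros)
    ultimately obtain top bot where top: "top \<in> C" "\<And>x. x \<in> C \<Longrightarrow> x $ j \<le> top $ j"
      and bot: "bot \<in> C" "\<And>x. x \<in> C \<Longrightarrow> bot $ j \<le> x $ j"
      using continuous_attains_sup[of C "\<lambda>x. x $ j"] continuous_attains_inf[of C "\<lambda>x. x $ j"] by metis
    \<comment> \<open>An interior point of \<open>K\<close> could be moved both ways along the
      chord, so neither end of the chord is interior.\<close>
    have shift: "\<exists>e>0. x + e *\<^sub>R axis j 1 \<in> C \<and> x - e *\<^sub>R axis j 1 \<in> C" if x: "x \<in> C" "x \<in> interior K" for x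
    proof -
      obtain e where e: "e > 0" "ball x e \<subseteq> K"
        using x(2) mem_interior by blast
      have "x + (e / 2) *\<^sub>R axis j 1 \<in> ball x e" "x - (e / 2) *\<^sub>R axis j 1 \<in> ball x e"
        using e(1) by (simp_all add: dist_norm norm_axis_1)
      then show ?thesis
        using e x(1) ij by (intro exI[of _ "e / 2"]) (auto simp: C_def axis_def)
    qed
    have "top \<notin> interior K"
    proof
      assume "top \<in> interior K"
      then obtain e where e: "e > 0" "top + e *\<^sub>R axis j 1 \<in> C"
        using shift[OF top(1)] by blast
      then show False
        using top(2)[OF e(2)] by simp
    qed
    moreover have "bot \<notin> interior K"
    proof
      assume "bot \<in> interior K"
      then obtain e where e: "e > 0" "bot - e *\<^sub>R axis j 1 \<in> C"
        using shift[OF bot(1)] by blast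
      then show False
        using bot(2)[OF e(2)] by simp
    qed
    moreover have "top \<in> K" "bot \<in> K"
      using top(1) bot(1) by (auto simp: C_def)
    moreover have "{p\<in>G. t \<in> J p} \<subseteq> {p\<in>G. a p \<bullet> top < r p} \<union> {p\<in>G. a p \<bullet> bot < r p}"
    proof clarify
      fix p assume p: "p \<in> G" "t \<in> J p" "\<not> a p \<bullet> bot < r p"
      then obtain x where x: "x \<in> C" "a p \<bullet> x < r p"
        by (auto simp: J_def C_def w)
      have i: "x $ i = t" "top $ i = t" "bot $ i = t"
        using x(1) top(1) bot(1) by (auto simp: C_def)
      \<comment> \<open>The cap contains a point of the chord but not its lower end. The functional
        thus decreases upwards along the chord, and the upper end lies in the cap.\<close>
      have "a p $ j * x $ j < a p $ j * bot $ j"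
        using x(2) p(3) i by (simp add: inner_plane[OF ij])
      then have "a p $ j < 0"
        using bot(2)[OF x(1)] by (smt (verit) mult_left_mono)
      then have "a p $ j * top $ j \<le> a p $ j * x $ j"
        using top(2)[OF x(1)] by (intro mult_left_mono_neg) auto
      then show "a p \<bullet> top < r p"
        using x(2) i by (simp add: inner_plane[OF ij])
    qed
    then have "card {p\<in>G. t \<in> J p} \<le> card {p\<in>G. a p \<bullet> top < r p} + card {p\<in>G. a p \<bullet> bot < r p}"
      using G by (intro order_trans[OF card_mono card_Un_le]) auto
    ultimately have "card {p\<in>G. t \<in> J p} \<le> 4"
      using at_most_two[of top] at_most_two[of bot] by linarith
    moreover have "(\<Sum>p\<in>G. indicator (J p) t) = real (card {p\<in>G. t \<in> J p})"
      using G by (simp add: indicator_def sum.If_cases Int_def)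
    ultimately show ?thesis
      using True by simp
  qed
  have int: "integrable lebesgue (indicator (J p) :: real \<Rightarrow> real)" "integral\<^sup>L lebesgue (indicator (J p)) = measure lebesgue (J p)" for p
    using Jm[of p] by (auto simp: fmeasurable_def intro!: integrable_real_indicator)
  have intL: "integrable lebesgue (indicator L :: real \<Rightarrow> real)" "integral\<^sup>L lebesgue (indicator L) = measure lebesgue L"
    using Lm by (auto simp: fmeasurable_def intro!: integrable_real_indicator)
  have "(\<Sum>p\<in>G. measure lebesgue (J p)) = (\<integral>t. (\<Sum>p\<in>G. indicator (J p) t) \<partial>lebesgue)"
    using int by (simp add: Bochner_Integration.integral_sum)
  also have "\<dots> \<le> (\<integral>t. 4 * indicator L t \<partial>lebesgue)"
    by (intro integral_mono overlap) (use int intL in auto)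
  also have "\<dots> = 4 * measure lebesgue L"
    using intL by simp
  finally show ?thesis
    by (simp add: J_def L_def w_def)
qed

text \<open>Half of \<open>\<delta>\<close> is spent on the countably many exceptional points, with
  geometrically decreasing bounds. The other half goes to the caps, whose bounds are proportional to
  their widths; minimality of the cover limits the sum of these widths.\<close>

lemma planar_majorant_cover:
  fixes K :: "(real ^ 2) set"
  assumes K: "convex K" "compact K" and \<delta>: "\<delta> > 0"
  obtains I U b c \<kappa> where "finite I" "extreme_points K \<subseteq> (\<Union>p\<in>I. U p)"
    "\<And>p. p \<in> I \<Longrightarrow> open (U p)"
    "\<And>p x. p \<in> I \<Longrightarrow> x \<in> K \<Longrightarrow> (x $ i - p $ i)\<^sup>2 \<le> c p + b p \<bullet> x"
    "\<And>p x. p \<in> I \<Longrightarrow> x \<in> K \<Longrightarrow> x \<in> U p \<Longrightarrow> c p + b p \<bullet> x \<le> \<kappa> p"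
    "\<And>p. p \<in> I \<Longrightarrow> \<kappa> p \<ge> 0" "(\<Sum>p\<in>I. \<kappa> p) \<le> \<delta>"
proof -
  define X where "X = extreme_points K"
  have X: "compact X"
    unfolding X_def by (rule compact_extreme_points_plane[OF K])
  define w where "w = (axis i 1 :: real ^ 2)"
  have w: "w \<bullet> x = x $ i" for x
    by (simp add: w_def inner_axis')
  define W where "W = measure lebesgue ((\<bullet>) w ` K)"
  have W: "W \<ge> 0" by (simp add: W_def)
  \<comment> \<open>The summand 1 keeps the denominator positive when \<open>K\<close> has zero
    width in coordinate \<open>i\<close>.\<close>
  define \<delta>' where "\<delta>' = \<delta> / (2 * (4 * W + 1))"
  have \<delta>': "\<delta>' > 0" "\<delta>' * (4 * W) \<le> \<delta> / 2"
    using \<delta> W by (simp_all add: \<delta>'_def field_simps)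
  define E where "E = {p. p extreme_point_of K \<and>
    \<not> (\<exists>a. (\<forall>x\<in>K. x \<noteq> p \<longrightarrow> a \<bullet> p < a \<bullet> x) \<and>
            (\<forall>e>0. \<exists>x\<in>K. x \<noteq> p \<and> a \<bullet> (x - p) < e * \<bar>x $ i - p $ i\<bar>))}"
  have E: "countable E"
    unfolding E_def by (rule countable_not_flat_exposed[OF K(1)])
  \<comment> \<open>Weights along an enumeration of \<open>E\<close>; over any finite subset of
    \<open>E\<close> they sum to at most \<open>\<delta> / 2\<close>.\<close>
  define h where "h = (\<lambda>p. \<delta> / 2 * (1 / 2) ^ Suc (to_nat_on E p))"
  have "\<forall>p\<in>X. \<exists>U b c \<kappa> a r. open U \<and> p \<in> U \<and> (\<forall>x\<in>K. (x $ i - p $ i)\<^sup>2 \<le> c + b \<bullet> x) \<and>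
      (\<forall>x\<in>K. x \<in> U \<longrightarrow> c + b \<bullet> x \<le> \<kappa>) \<and> \<kappa> \<ge> 0 \<and> (p \<in> E \<longrightarrow> \<kappa> \<le> h p) \<and>
      (p \<notin> E \<longrightarrow> U = {x. a \<bullet> x < r} \<and> \<kappa> \<le> \<delta>' * measure lebesgue ((\<bullet>) w ` {x\<in>K. a \<bullet> x < r}))"
  proof
    fix p assume "p \<in> X"
    then have ext: "p extreme_point_of K" by (simp add: X_def extreme_points_def)
    then have pK: "p \<in> K" by (simp add: extreme_point_of_def)
    show "\<exists>U b c \<kappa> a r. open U \<and> p \<in> U \<and> (\<forall>x\<in>K. (x $ i - p $ i)\<^sup>2 \<le> c + b \<bullet> x) \<and>
      (\<forall>x\<in>K. x \<in> U \<longrightarrow> c + b \<bullet> x \<le> \<kappa>) \<and> \<kappa> \<ge> 0 \<and> (p \<in> E \<longrightarrow> \<kappa> \<le> h p) \<and>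
      (p \<notin> E \<longrightarrow> U = {x. a \<bullet> x < r} \<and> \<kappa> \<le> \<delta>' * measure lebesgue ((\<bullet>) w ` {x\<in>K. a \<bullet> x < r}))"
    proof (cases "p \<in> E")
      case True
      have hp: "h p > 0"
        using \<delta> by (simp add: h_def)
      have cont: "continuous_on K (\<lambda>x. (x $ i - p $ i)\<^sup>2)"
        by (intro continuous_intros)
      obtain b c where bc: "\<And>x. x \<in> K \<Longrightarrow> (x $ i - p $ i)\<^sup>2 \<le> c + b \<bullet> x"
        "c + b \<bullet> p < (p $ i - p $ i)\<^sup>2 + h p"
        using extreme_point_affine_majorant[OF K ext cont hp] by blast
      have "open {x. c + b \<bullet> x < h p}"
        by (intro open_Collect_less continuous_intros)
      then show ?thesis
        using bc hp True
        by (intro exI[of _ "{x. c + b \<bullet> x < h p}"] exI[of _ b] exI[of _ c] exI[of _ "h p"]) auto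
    next
      case False
      then obtain a where a: "\<And>x. x \<in> K \<Longrightarrow> x \<noteq> p \<Longrightarrow> a \<bullet> p < a \<bullet> x"
        "\<And>e. e > 0 \<Longrightarrow> \<exists>x\<in>K. x \<noteq> p \<and> a \<bullet> (x - p) < e * \<bar>w \<bullet> (x - p)\<bar>"
        using ext by (auto simp: E_def w)
      show ?thesis
      proof (rule cap_majorant[OF K pK a \<delta>'(1)])
        fix r \<kappa> b c
        assume "a \<bullet> p < r" "\<kappa> \<ge> 0" "\<And>x. x \<in> K \<Longrightarrow> (w \<bullet> x - w \<bullet> p)\<^sup>2 \<le> c + b \<bullet> x"
          "\<And>x. x \<in> K \<Longrightarrow> a \<bullet> x < r \<Longrightarrow> c + b \<bullet> x \<le> \<kappa>"
          "\<kappa> \<le> \<delta>' * measure lebesgue ((\<bullet>) w ` {x\<in>K. a \<bullet> x < r})"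
        then show ?thesis
          using False
          by (intro exI[of _ "{x. a \<bullet> x < r}"] exI[of _ b] exI[of _ c] exI[of _ \<kappa>] exI[of _ a] exI[of _ r])
            (simp add: w open_halfspace_lt)
      qed
    qed
  qed
  then obtain U b c \<kappa> a r where UP: "\<And>p. p \<in> X \<Longrightarrow> open (U p) \<and> p \<in> U p \<and> (\<forall>x\<in>K. (x $ i - p $ i)\<^sup>2 \<le> c p + b p \<bullet> x) \<and>
      (\<forall>x\<in>K. x \<in> U p \<longrightarrow> c p + b p \<bullet> x \<le> \<kappa> p) \<and> \<kappa> p \<ge> 0 \<and> (p \<in> E \<longrightarrow> \<kappa> p \<le> h p) \<and>
      (p \<notin> E \<longrightarrow> U p = {x. a p \<bullet> x < r p} \<and> \<kappa> p \<le> \<delta>' * measure lebesgue ((\<bullet>) w ` {x\<in>K. a p \<bullet> x < r p}))"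
    unfolding bchoice_iff by blast
  define cover where "cover = (\<lambda>D. finite D \<and> D \<subseteq> X \<and> X \<subseteq> (\<Union>p\<in>D. U p))"
  have "\<exists>D. cover D"
  proof -
    have "X \<subseteq> (\<Union>p\<in>X. U p)"
      using UP by auto
    then obtain D where "D \<subseteq> X" "finite D" "X \<subseteq> (\<Union>p\<in>D. U p)"
      using compactE_image[OF X, of X U] UP by metis
    then show ?thesis
      by (auto simp: cover_def)
  qed
  then obtain D where D: "cover D" "\<And>D'. cover D' \<Longrightarrow> card D \<le> card D'"
    using ex_has_least_nat[of cover _ card] by blast
  then have D': "finite D" "D \<subseteq> X" "X \<subseteq> (\<Union>p\<in>D. U p)"
    by (auto simp: cover_def)
  \<comment> \<open>Minimal cardinality gives each member of the cover a private extreme point;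
    these are the points required by \<open>sum_cap_widths\<close>.\<close>
  have "\<exists>y\<in>X. y \<in> U p \<and> (\<forall>q\<in>D. q \<noteq> p \<longrightarrow> y \<notin> U q)" if p: "p \<in> D" for p
  proof (rule ccontr)
    assume "\<not> ?thesis"
    then have "X \<subseteq> (\<Union>q\<in>D - {p}. U q)"
      using D'(3) by blast
    then have "cover (D - {p})"
      using D' by (auto simp: cover_def)
    then have "card D \<le> card (D - {p})"
      by (rule D(2))
    then show False
      using card_Diff1_less[OF D'(1) p] by linarith
  qed
  then obtain y where y: "\<And>p. p \<in> D \<Longrightarrow> y p \<in> X" "\<And>p. p \<in> D \<Longrightarrow> y p \<in> U p"
    "\<And>p q. p \<in> D \<Longrightarrow> q \<in> D \<Longrightarrow> q \<noteq> p \<Longrightarrow> y p \<notin> U q"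
    by metis
  define G where "G = D - E"
  have GU: "U p = {x. a p \<bullet> x < r p}" if "p \<in> G" for p
    using UP[of p] that D'(2) by (auto simp: G_def)
  have "(\<Sum>p\<in>G. \<kappa> p) \<le> (\<Sum>p\<in>G. \<delta>' * measure lebesgue ((\<bullet>) w ` {x\<in>K. a p \<bullet> x < r p}))"
    using UP D'(2) by (intro sum_mono) (auto simp: G_def)
  also have "\<dots> = \<delta>' * (\<Sum>p\<in>G. measure lebesgue ((\<bullet>) w ` {x\<in>K. a p \<bullet> x < r p}))"
    by (rule sum_distrib_left[symmetric])
  also have "\<dots> \<le> \<delta>' * (4 * W)"
    unfolding W_def w_def
  proof (intro mult_left_mono sum_cap_widths[OF K, where y = y])
    fix p assume p: "p \<in> G"
    then have pD: "p \<in> D" by (simp add: G_def)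
    show "y p extreme_point_of K"
      using y(1)[OF pD] by (simp add: X_def extreme_points_def)
    show "a p \<bullet> y p < r p"
      using y(2)[OF pD] GU[OF p] by simp
    fix q assume q: "q \<in> G" "q \<noteq> p"
    then have "y q \<notin> U p"
      using y(3)[of q p] pD by (simp add: G_def)
    then show "r p \<le> a p \<bullet> y q"
      using GU[OF p] by simp
  qed (use D'(1) \<delta>' in \<open>auto simp: G_def\<close>)
  also note \<delta>'(2)
  finally have sumG: "(\<Sum>p\<in>G. \<kappa> p) \<le> \<delta> / 2" .
  have "(\<Sum>p\<in>D \<inter> E. \<kappa> p) \<le> (\<Sum>p\<in>D \<inter> E. h p)"
    using UP D'(2) by (intro sum_mono) auto
  also have "\<dots> = (\<Sum>n\<in>to_nat_on E ` (D \<inter> E). \<delta> / 2 * (1 / 2) ^ Suc n)"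
    by (subst sum.reindex) (auto simp: h_def intro!: inj_on_subset[OF inj_on_to_nat_on[OF E]])
  also have "\<dots> = \<delta> / 2 * (\<Sum>n\<in>to_nat_on E ` (D \<inter> E). (1 / 2) ^ Suc n)"
    by (rule sum_distrib_left[symmetric])
  also have "\<dots> \<le> \<delta> / 2 * 1"
  proof (rule mult_left_mono)
    have "(\<Sum>n\<in>to_nat_on E ` (D \<inter> E). (1 / 2 :: real) ^ Suc n) \<le> (\<Sum>n. (1 / 2) ^ Suc n)"
      using D'(1) power_half_series by (intro sum_le_suminf) (auto simp: sums_iff)
    then show "(\<Sum>n\<in>to_nat_on E ` (D \<inter> E). (1 / 2 :: real) ^ Suc n) \<le> 1"
      using power_half_series by (simp add: sums_iff)
  qed (use \<delta> in simp)
  finally have "(\<Sum>p\<in>D \<inter> E. \<kappa> p) \<le> \<delta> / 2"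
    by simp
  then have "(\<Sum>p\<in>D. \<kappa> p) \<le> \<delta>"
    using sumG sum.Int_Diff[OF D'(1), of \<kappa> E] by (simp add: G_def)
  then show ?thesis
    using that[of D U c b \<kappa>] UP D' unfolding X_def[symmetric] by blast
qed

subsection \<open>Complex Hilbert spaces and completely positive maps\<close>

lemma cinner_add_left: "cinner (x + y) z = cinner x z + cinner y z"
  by (metis cinner_add_right cinner_commute complex_cnj_add)

lemma cinner_scaleC_left: "cinner (c *\<^sub>C x) y = cnj c * cinner x y"
  by (metis cinner_commute cinner_scaleC_right complex_cnj_mult)

lemma cinner_zero [simp]: "cinner x 0 = 0" "cinner 0 x = 0"
  using cinner_add_right[of x 0 0] cinner_add_left[of 0 0 x] by auto

lemma cinner_minus_right [simp]: "cinner x (- y) = - cinner x y"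
  using cinner_add_right[of x y "- y"] by (simp add: add_eq_0_iff)

lemma cinner_minus_left [simp]: "cinner (- x) y = - cinner x y"
  using cinner_add_left[of x "- x" y] by (simp add: add_eq_0_iff)

lemma cinner_diff_right: "cinner x (y - z) = cinner x y - cinner x z"
  using cinner_add_right[of x y "- z"] by simp

lemma cinner_scaleR_right: "cinner x (r *\<^sub>R y) = of_real r * cinner x y"
  by (metis cinner_scaleC_right scaleC_of_real)

lemma cinner_scaleR_left: "cinner (r *\<^sub>R x) y = of_real r * cinner x y"
  by (metis cinner_scaleC_left scaleC_of_real complex_cnj_complex_of_real)

lemma cinner_eq_zeroD: "x = 0" if "\<And>y. cinner y x = 0"
  using that[of x] by (simp add: cinner_self)

lemma scaleC_one [simp]: "1 *\<^sub>C (x :: 'h::chilbert_space) = x"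
  using scaleC_of_real[of 1 x] by simp

text \<open>Along a real line an affine function with values in the nonnegative reals is constant.
  Real \<open>c\<close> gives \<open>a + b = 0\<close> and imaginary \<open>c\<close> gives
  \<open>b = a\<close>. This is how an off-diagonal entry of a positive form is shown to vanish when
  its diagonal partner is zero.\<close>

lemma nonneg_affine_imp_zero:
  assumes "\<And>c. cnj c * a + c * b + s \<in> \<real>\<^sub>\<ge>\<^sub>0"
  shows "a = (0::complex)"
proof -
  have *: "z = 0" if z: "\<And>t. complex_of_real t * z + s \<in> \<real>\<^sub>\<ge>\<^sub>0" for z
  proof -
    have s: "Re s \<ge> 0" "Im s = 0"
      using z[of 0] by (auto simp: complex_nonneg_Reals_iff)
    have "Im z = 0"
      using z[of 1] s by (auto simp: complex_nonneg_Reals_iff)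
    moreover have "Re z = 0"
    proof (rule ccontr)
      assume "Re z \<noteq> 0"
      then show False
        using z[of "- (Re s + 1) / Re z"] by (auto simp: complex_nonneg_Reals_iff)
    qed
    ultimately show ?thesis by (simp add: complex_eq_iff)
  qed
  have "a + b = 0"
    by (rule *) (use assms[of "of_real _"] in \<open>simp add: algebra_simps\<close>)
  moreover have "\<i> * (b - a) = 0"
    by (rule *) (use assms[of "\<i> * of_real _"] in \<open>simp add: algebra_simps\<close>)
  ultimately show ?thesis by (simp add: complex_eq_iff)
qed

text \<open>Complex polarisation for \<open>S - T\<close>: membership in \<open>bounded_ops\<close>
  allows the scalar \<open>c\<close> to pass through the difference.\<close>

lemma bounded_ops_eqI:
  fixes S T :: "'h::chilbert_space \<Rightarrow>\<^sub>L 'h"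
  assumes "S \<in> bounded_ops" "T \<in> bounded_ops"
    and "\<And>v. cinner v (S v) = cinner v (T v)"
  shows "S = T"
proof -
  define R where "R = S - T"
  have R: "cinner v (R v) = 0" for v
    using assms(3) by (simp add: R_def minus_blinfun.rep_eq cinner_diff_right)
  have lin: "R (c *\<^sub>C v) = c *\<^sub>C R v" for c v
  proof (rule eq_iff_diff_eq_0[THEN iffD2], rule cinner_eq_zeroD)
    fix y
    have "R (c *\<^sub>C v) = c *\<^sub>C S v - c *\<^sub>C T v"
      using assms(1,2) by (simp add: R_def minus_blinfun.rep_eq bounded_ops_def)
    then have "cinner y (R (c *\<^sub>C v)) = c * (cinner y (S v) - cinner y (T v))"
      by (simp only: cinner_diff_right cinner_scaleC_right right_diff_distrib)
    then show "cinner y (R (c *\<^sub>C v) - c *\<^sub>C R v) = 0"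
      by (simp add: cinner_diff_right cinner_scaleC_right) (simp add: R_def minus_blinfun.rep_eq cinner_diff_right)
  qed
  have "R w = 0" for w
  proof (rule cinner_eq_zeroD)
    fix v
    show "cinner v (R w) = 0"
    proof (rule nonneg_affine_imp_zero)
      fix c
      have "cinner (c *\<^sub>C v + w) (R (c *\<^sub>C v + w)) = 0"
        by (rule R)
      then show "cnj c * cinner v (R w) + c * cinner w (R v) + 0 \<in> \<real>\<^sub>\<ge>\<^sub>0"
        using R[of v] R[of w]
        by (simp add: blinfun.add_right lin cinner_add_left cinner_add_right cinner_scaleC_left
            cinner_scaleC_right add.commute)
    qed
  qed
  then show ?thesis
    by (intro blinfun_eqI) (simp add: R_def minus_blinfun.rep_eq)
qed

section \<open>Real functions as elements of \<open>C(X)\<close>, and positivity\<close>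

definition rfun :: "'a set \<Rightarrow> ('a \<Rightarrow> real) \<Rightarrow> 'a \<Rightarrow> complex" where
  "rfun X g = (\<lambda>x. if x \<in> X then complex_of_real (g x) else 0)"

lemma rfun_cong: "(\<And>x. x \<in> X \<Longrightarrow> f x = g x) \<Longrightarrow> rfun X f = rfun X g"
  by (auto simp: rfun_def)

lemma rfun_in_cfun_algebra [intro]: "continuous_on X g \<Longrightarrow> rfun X g \<in> cfun_algebra X"
  unfolding cfun_algebra_def rfun_def
  by (auto intro: continuous_on_eq[of _ "\<lambda>x. complex_of_real (g x)"] continuous_intros)

lemma rfun_zero: "rfun X (\<lambda>_. 0) = (\<lambda>_. 0)"
  by (auto simp: rfun_def)

lemma rfun_add: "rfun X (\<lambda>x. f x + g x) = (\<lambda>x. rfun X f x + rfun X g x)"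
  and rfun_scale: "rfun X (\<lambda>x. r * f x) = (\<lambda>x. of_real r * rfun X f x)"
  and rfun_mult: "rfun X (\<lambda>x. f x * g x) = (\<lambda>x. rfun X f x * rfun X g x)"
  and rfun_cnj: "(\<lambda>x. cnj (rfun X f x)) = rfun X f"
  by (auto simp: rfun_def)

lemma cfun_one_eq_rfun: "cfun_one X = rfun X (\<lambda>_. 1)"
  by (auto simp: cfun_one_def rfun_def)

lemma zero_in_cfun_algebra [simp]: "(\<lambda>x. 0) \<in> cfun_algebra X"
  by (simp add: cfun_algebra_def)

lemma cfun_algebra_mult [intro]:
  "f \<in> cfun_algebra X \<Longrightarrow> g \<in> cfun_algebra X \<Longrightarrow> (\<lambda>x. f x * g x) \<in> cfun_algebra X"
  unfolding cfun_algebra_def by (auto intro: continuous_intros)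

lemma cfun_algebra_scale [intro]:
  "f \<in> cfun_algebra X \<Longrightarrow> (\<lambda>x. c * f x) \<in> cfun_algebra X"
  unfolding cfun_algebra_def by (auto intro: continuous_intros)

lemma cfun_algebra_cnj [intro]:
  "f \<in> cfun_algebra X \<Longrightarrow> (\<lambda>x. cnj (f x)) \<in> cfun_algebra X"
  unfolding cfun_algebra_def by (auto intro: continuous_on_cnj)

text \<open>The form in which complete positivity is used below. The matrix is of the shape
  \<open>B* B\<close>, where \<open>B\<close> has the functions \<open>g i\<close> in row 0 and
  zeros elsewhere.\<close>

lemma ucp_map_row:
  fixes \<phi> :: "('a::topological_space \<Rightarrow> complex) \<Rightarrow> ('h::chilbert_space \<Rightarrow>\<^sub>L 'h)"
    and n :: nat
  assumes "ucp_map X \<phi>" and g: "\<And>i. g i \<in> cfun_algebra X"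
  shows "(\<Sum>i<n. cinner (v i) (\<Sum>j<n. \<phi> (\<lambda>x. cnj (g i x) * g j x) (v j))) \<in> \<real>\<^sub>\<ge>\<^sub>0"
proof -
  define B where "B = (\<lambda>k::nat. \<lambda>i x. if k = 0 then g i x else 0)"
  have "positive_cfun_matrix X n (\<lambda>i j x. cnj (g i x) * g j x)"
    unfolding positive_cfun_matrix_def
  proof (intro exI[of _ B] conjI allI impI)
    fix i j :: nat
    show "B i j \<in> cfun_algebra X"
      using g by (cases "i = 0") (auto simp: B_def)
    assume "i < n"
    have "(\<Sum>k<n. cnj (B k i x) * B k j x) = (\<Sum>k<n. if k = 0 then cnj (g i x) * g j x else 0)" for x
      by (rule sum.cong) (auto simp: B_def)
    then show "(\<lambda>x. cnj (g i x) * g j x) = (\<lambda>x. \<Sum>k<n. cnj (B k i x) * B k j x)"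
      using \<open>i < n\<close> by auto
  qed
  then have "positive_op_matrix n (\<lambda>i j. \<phi> (\<lambda>x. cnj (g i x) * g j x))"
    using assms(1) unfolding ucp_map_def by blast
  then show ?thesis
    unfolding positive_op_matrix_def by blast
qed

text \<open>The discriminant criterion for a quadratic that is nonnegative on the whole real line,
  with the degenerate case of a zero leading coefficient included.\<close>

lemma psd_quadratic_bound:
  fixes a b s :: real
  assumes "\<And>t. a + t * s + t\<^sup>2 * b \<ge> 0"
  shows "s\<^sup>2 \<le> 4 * a * b"
proof (cases "b = 0")
  case True
  have "s = 0"
  proof (rule ccontr)
    assume "s \<noteq> 0"
    then show False
      using assms[of "- (a + 1) / s"] True by simp
  qed
  then show ?thesis using True by simp
next
  case False
  have "b > 0"
  proof (rule ccontr)
    assume "\<not> b > 0"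
    then have b: "b < 0" using False by simp
    define t where "t = 1 + (\<bar>a\<bar> + \<bar>s\<bar>) / (- b)"
    have t: "t \<ge> 1" "t * b = b - (\<bar>a\<bar> + \<bar>s\<bar>)"
      using b by (auto simp: t_def field_simps divide_nonneg_neg mult_nonneg_nonpos)
    have "t\<^sup>2 * b = t * (b - (\<bar>a\<bar> + \<bar>s\<bar>))"
      using t(2) by (simp add: power2_eq_square)
    then have "a + t * s + t\<^sup>2 * b = a + t * (s - \<bar>s\<bar>) + t * b - t * \<bar>a\<bar>"
      by (simp add: algebra_simps)
    also have "\<dots> < 0"
    proof -
      have "t * (s - \<bar>s\<bar>) \<le> 0" using t by (intro mult_nonneg_nonpos) auto
      moreover have "t * b < 0" using t b by (intro mult_pos_neg) auto
      moreover have "t * \<bar>a\<bar> \<ge> 1 * \<bar>a\<bar>" using t by (intro mult_right_mono) auto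
      ultimately show ?thesis by linarith
    qed
    finally show False using assms[of t] by linarith
  qed
  then have "a + (- s / (2 * b)) * s + (- s / (2 * b))\<^sup>2 * b = a - s\<^sup>2 / (4 * b)"
    by (simp add: field_simps power2_eq_square)
  then have "s\<^sup>2 / (4 * b) \<le> a"
    using assms[of "- s / (2 * b)"] by linarith
  then show ?thesis
    using \<open>b > 0\<close> by (simp add: field_simps)
qed

section \<open>Comparing a unital completely positive map with a homomorphism\<close>

locale ucp_extension =
  fixes X :: "'a::topological_space set"
    and \<pi> \<phi> :: "('a \<Rightarrow> complex) \<Rightarrow> ('h::chilbert_space \<Rightarrow>\<^sub>L 'h)"
  assumes star_hom: "unital_star_hom X \<pi>"
    and ucp: "ucp_map X \<phi>"
begin

lemma phi_linear: "unital_linear_map X \<phi>"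
  using ucp by (simp add: ucp_map_def)

lemma pi_linear: "unital_linear_map X \<pi>"
  using star_hom by (simp add: unital_star_hom_def)

lemma phi_add: "f \<in> cfun_algebra X \<Longrightarrow> g \<in> cfun_algebra X \<Longrightarrow> \<phi> (\<lambda>x. f x + g x) = \<phi> f + \<phi> g"
  and phi_scale: "f \<in> cfun_algebra X \<Longrightarrow> \<phi> (\<lambda>x. c * f x) v = c *\<^sub>C \<phi> f v"
  and phi_one: "\<phi> (cfun_one X) = id_blinfun"
  and phi_bounded: "f \<in> cfun_algebra X \<Longrightarrow> \<phi> f \<in> bounded_ops"
  using phi_linear by (auto simp: unital_linear_map_def)

lemma pi_add: "f \<in> cfun_algebra X \<Longrightarrow> g \<in> cfun_algebra X \<Longrightarrow> \<pi> (\<lambda>x. f x + g x) = \<pi> f + \<pi> g"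
  and pi_scale: "f \<in> cfun_algebra X \<Longrightarrow> \<pi> (\<lambda>x. c * f x) v = c *\<^sub>C \<pi> f v"
  and pi_one: "\<pi> (cfun_one X) = id_blinfun"
  and pi_bounded: "f \<in> cfun_algebra X \<Longrightarrow> \<pi> f \<in> bounded_ops"
  using pi_linear by (auto simp: unital_linear_map_def)

lemma pi_mult:
  "f \<in> cfun_algebra X \<Longrightarrow> g \<in> cfun_algebra X \<Longrightarrow> \<pi> (\<lambda>x. f x * g x) = \<pi> f o\<^sub>L \<pi> g"
  using star_hom by (auto simp: unital_star_hom_def)

lemma pi_adjoint:
  "f \<in> cfun_algebra X \<Longrightarrow> cinner (\<pi> (\<lambda>x. cnj (f x)) v) w = cinner v (\<pi> f w)"
  using star_hom by (auto simp: unital_star_hom_def)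

definition phi_form :: "('a \<Rightarrow> real) \<Rightarrow> 'h \<Rightarrow> real" where
  "phi_form g v = Re (cinner v (\<phi> (rfun X g) v))"

definition pi_form :: "('a \<Rightarrow> real) \<Rightarrow> 'h \<Rightarrow> real" where
  "pi_form g v = Re (cinner v (\<pi> (rfun X g) v))"

lemma pi_rfun_adjoint:
  "continuous_on X f \<Longrightarrow> cinner (\<pi> (rfun X f) v) w = cinner v (\<pi> (rfun X f) w)"
  using pi_adjoint[of "rfun X f" v w] by (simp add: rfun_cnj rfun_in_cfun_algebra)

lemma pi_form_real:
  assumes "continuous_on X f"
  shows "Im (cinner v (\<pi> (rfun X f) v)) = 0"
proof -
  have "cnj (cinner v (\<pi> (rfun X f) v)) = cinner v (\<pi> (rfun X f) v)"
    using pi_rfun_adjoint[OF assms, of v v] cinner_commute[of "\<pi> (rfun X f) v" v] by simp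
  then show ?thesis
    by (simp add: complex_eq_iff)
qed

lemma phi_form_add:
  "continuous_on X f \<Longrightarrow> continuous_on X g \<Longrightarrow> phi_form (\<lambda>x. f x + g x) v = phi_form f v + phi_form g v"
  by (simp add: phi_form_def rfun_add phi_add rfun_in_cfun_algebra plus_blinfun.rep_eq cinner_add_right)

lemma pi_form_add:
  "continuous_on X f \<Longrightarrow> continuous_on X g \<Longrightarrow> pi_form (\<lambda>x. f x + g x) v = pi_form f v + pi_form g v"
  by (simp add: pi_form_def rfun_add pi_add rfun_in_cfun_algebra plus_blinfun.rep_eq cinner_add_right)

lemma phi_form_scale:
  "continuous_on X f \<Longrightarrow> phi_form (\<lambda>x. r * f x) v = r * phi_form f v"
  by (simp add: phi_form_def rfun_scale phi_scale rfun_in_cfun_algebra cinner_scaleC_right)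

lemma pi_form_scale:
  "continuous_on X f \<Longrightarrow> pi_form (\<lambda>x. r * f x) v = r * pi_form f v"
  by (simp add: pi_form_def rfun_scale pi_scale rfun_in_cfun_algebra cinner_scaleC_right)

lemma phi_form_one: "phi_form (\<lambda>_. 1) v = (norm v)\<^sup>2"
  by (simp add: phi_form_def phi_one flip: cfun_one_eq_rfun) (simp add: cinner_self)

lemma pi_form_one: "pi_form (\<lambda>_. 1) v = (norm v)\<^sup>2"
  by (simp add: pi_form_def pi_one flip: cfun_one_eq_rfun) (simp add: cinner_self)

text \<open>\<open>\<pi>\<close> is multiplicative and \<open>\<pi>(f)\<close> is self-adjoint, so
  the two factors \<open>f\<close> can be moved onto the two copies of \<open>v\<close>. This
  localises an estimate to the support of \<open>f\<close>.\<close>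

lemma pi_form_mult:
  assumes "continuous_on X f" "continuous_on X g"
  shows "pi_form (\<lambda>x. g x * (f x * f x)) v = pi_form g (\<pi> (rfun X f) v)"
proof -
  have "rfun X (\<lambda>x. g x * (f x * f x)) = (\<lambda>x. rfun X f x * (rfun X g x * rfun X f x))"
    by (auto simp: rfun_def)
  then show ?thesis
    using assms
    by (simp add: pi_form_def pi_mult rfun_in_cfun_algebra cfun_algebra_mult pi_rfun_adjoint)
qed

lemma norm_pi: "continuous_on X f \<Longrightarrow> (norm (\<pi> (rfun X f) v))\<^sup>2 = pi_form (\<lambda>x. f x * f x) v"
  using pi_form_mult[of f "\<lambda>_. 1" v] by (simp add: pi_form_one)

text \<open>The difference is a square \<open>h * h\<close>, on which \<open>pi_form\<close> is a
  squared norm.\<close>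

lemma pi_form_mono:
  assumes "continuous_on X f" "continuous_on X g" "\<And>x. x \<in> X \<Longrightarrow> f x \<le> g x"
  shows "pi_form f v \<le> pi_form g v"
proof -
  define h where "h = (\<lambda>x. sqrt (g x - f x))"
  have h: "continuous_on X h"
    unfolding h_def by (intro continuous_intros assms)
  have "rfun X g = rfun X (\<lambda>x. f x + h x * h x)"
    by (rule rfun_cong) (use assms(3) in \<open>simp add: h_def\<close>)
  then have "pi_form g v = pi_form f v + pi_form (\<lambda>x. h x * h x) v"
    using pi_form_add[of f "\<lambda>x. h x * h x" v] assms h
    by (simp add: pi_form_def continuous_on_mult)
  then show ?thesis
    using norm_pi[OF h, of v] by (metis le_add_same_cancel1 zero_le_power2)
qed

text \<open>Again the difference is a square; positivity of \<open>\<phi>\<close> on squares is the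
  case of 1 x 1 matrices.\<close>

lemma phi_form_mono:
  assumes "continuous_on X f" "continuous_on X g" "\<And>x. x \<in> X \<Longrightarrow> f x \<le> g x"
  shows "phi_form f v \<le> phi_form g v"
proof -
  define h where "h = (\<lambda>x. sqrt (g x - f x))"
  have h: "continuous_on X h"
    unfolding h_def by (intro continuous_intros assms)
  have "rfun X g = rfun X (\<lambda>x. f x + h x * h x)"
    by (rule rfun_cong) (use assms(3) in \<open>simp add: h_def\<close>)
  then have "phi_form g v = phi_form f v + phi_form (\<lambda>x. h x * h x) v"
    using phi_form_add[of f "\<lambda>x. h x * h x" v] assms h
    by (simp add: phi_form_def continuous_on_mult)
  moreover have "cinner v (\<phi> (\<lambda>x. cnj (rfun X h x) * rfun X h x) v) \<in> \<real>\<^sub>\<ge>\<^sub>0"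
    using ucp_map_row[OF ucp, where g = "\<lambda>_. rfun X h" and n = 1 and v = "\<lambda>_. v"] h by (simp add: rfun_in_cfun_algebra)
  then have "phi_form (\<lambda>x. h x * h x) v \<ge> 0"
    by (simp add: phi_form_def rfun_mult rfun_cnj[THEN fun_cong] complex_nonneg_Reals_iff)
  ultimately show ?thesis
    by linarith
qed

section \<open>Variance estimates\<close>

text \<open>When \<open>\<phi>(f) = \<pi>(f)\<close>, this is the variance of \<open>f\<close> under \<open>\<phi>\<close>; it vanishes identically iff \<open>f\<close>
  lies in the multiplicative domain of \<open>\<phi>\<close>.\<close>

definition variance :: "('a \<Rightarrow> real) \<Rightarrow> 'h \<Rightarrow> real" where
  "variance f v = phi_form (\<lambda>x. f x * f x) v - (norm (\<pi> (rfun X f) v))\<^sup>2"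

text \<open>The Kadison--Schwarz inequality: the 2 x 2 matrix of the row \<open>(1, f)\<close> is
  tested on the vector \<open>(- T v, v)\<close>, whose first component completes the
  square.\<close>

lemma variance_nonneg:
  assumes f: "continuous_on X f" and eq: "\<phi> (rfun X f) = \<pi> (rfun X f)"
  shows "variance f v \<ge> 0"
proof -
  define T where "T = \<pi> (rfun X f)"
  define g where "g = (\<lambda>i::nat. if i = 0 then cfun_one X else rfun X f)"
  define w where "w = (\<lambda>i::nat. if i = 0 then - T v else v)"
  have g: "g i \<in> cfun_algebra X" for i
    using f by (auto simp: g_def cfun_one_eq_rfun)
  have row: "(\<lambda>x. cnj (g 0 x) * g 0 x) = cfun_one X" "(\<lambda>x. cnj (g 0 x) * g 1 x) = rfun X f"
    "(\<lambda>x. cnj (g 1 x) * g 0 x) = rfun X f"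
    "(\<lambda>x. cnj (g 1 x) * g 1 x) = rfun X (\<lambda>x. f x * f x)"
    by (auto simp: g_def cfun_one_def rfun_def)
  have "cinner (w 0) (\<phi> (cfun_one X) (w 0) + \<phi> (rfun X f) (w 1))
     + cinner (w 1) (\<phi> (rfun X f) (w 0) + \<phi> (rfun X (\<lambda>x. f x * f x)) (w 1)) \<in> \<real>\<^sub>\<ge>\<^sub>0"
    using ucp_map_row[where g = g and n = 2 and v = w, OF ucp g] by (simp add: numeral_2_eq_2 row[unfolded One_nat_def])
  then have "cinner v (\<phi> (rfun X (\<lambda>x. f x * f x)) v - T (T v)) \<in> \<real>\<^sub>\<ge>\<^sub>0"
    unfolding phi_one eq by (simp add: w_def T_def blinfun.minus_right)
  then have "Re (cinner v (T (T v))) \<le> phi_form (\<lambda>x. f x * f x) v"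
    by (simp add: cinner_diff_right complex_nonneg_Reals_iff phi_form_def)
  moreover have "cinner v (T (T v)) = of_real ((norm (T v))\<^sup>2)"
    using pi_rfun_adjoint[OF f, of v "T v"] by (simp add: T_def cinner_self)
  ultimately show ?thesis
    by (simp add: variance_def T_def)
qed

text \<open>The variance is a positive semidefinite quadratic form, so its cross term
  \<open>c\<close> obeys a Cauchy--Schwarz bound. The inequality of the means turns this into
  \<open>c \<le> a * s + b * r\<close>, exactly the mixed terms of the product; the two kinds of
  factors can thus be summed separately.\<close>

lemma variance_add_le:
  assumes f: "continuous_on X f" and eq: "\<phi> (rfun X f) = \<pi> (rfun X f)"
    and v: "variance f v \<le> a * r" and w: "variance f w \<le> b * s"
    and pos: "a \<ge> 0" "b \<ge> 0" "r \<ge> 0" "s \<ge> 0"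
  shows "variance f (v + w) \<le> (a + b) * (r + s)"
proof -
  define T where "T = \<pi> (rfun X f)"
  define S where "S = \<phi> (rfun X (\<lambda>x. f x * f x))"
  define c where "c = Re (cinner v (S w) + cinner w (S v) - cinner (T v) (T w) - cinner (T w) (T v))"
  have var: "variance f u = Re (cinner u (S u) - cinner (T u) (T u))" for u
    by (simp add: variance_def phi_form_def S_def T_def cinner_self flip: of_real_power)
  have expand: "variance f (v + t *\<^sub>R w) = variance f v + t * c + t\<^sup>2 * variance f w" for t
    unfolding var c_def
    by (simp add: blinfun.add_right blinfun.scaleR_right cinner_add_left cinner_add_right
        cinner_scaleR_left cinner_scaleR_right algebra_simps power2_eq_square)
  have nn: "variance f v \<ge> 0" "variance f w \<ge> 0"
    by (rule variance_nonneg[OF f eq])+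
  have "c\<^sup>2 \<le> 4 * variance f v * variance f w"
    by (rule psd_quadratic_bound) (use variance_nonneg[OF f eq] expand in metis)
  also have "\<dots> \<le> 4 * (a * r) * (b * s)"
    by (intro mult_mono v w nn) (use pos in auto)
  also have "\<dots> = 4 * (a * s) * (b * r)"
    by simp
  also have "\<dots> \<le> (a * s + b * r)\<^sup>2"
    using zero_le_power2[of "a * s - b * r"] by (simp add: power2_sum power2_diff mult_ac)
  finally have "c \<le> a * s + b * r"
    by (rule power2_le_imp_le) (use pos in auto)
  then show ?thesis
    using expand[of 1] v w by (simp add: algebra_simps)
qed

lemma variance_zero: "variance f 0 = 0"
  by (simp add: variance_def phi_form_def)

lemma variance_sum_le:
  assumes f: "continuous_on X f" and eq: "\<phi> (rfun X f) = \<pi> (rfun X f)"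
    and "finite I"
    and v: "\<And>i. i \<in> I \<Longrightarrow> variance f (v i) \<le> a i * r i"
    and pos: "\<And>i. i \<in> I \<Longrightarrow> a i \<ge> 0" "\<And>i. i \<in> I \<Longrightarrow> r i \<ge> 0"
  shows "variance f (\<Sum>i\<in>I. v i) \<le> (\<Sum>i\<in>I. a i) * (\<Sum>i\<in>I. r i)"
  using \<open>finite I\<close> v pos
proof (induction I rule: finite_induct)
  case (insert i I)
  then show ?case
    by (simp add: variance_add_le[OF f eq] sum_nonneg)
qed (simp add: variance_zero)

text \<open>Subtracting the constant \<open>c\<close> does not change the variance, which is
  therefore at most the \<open>phi_form\<close> of the square of \<open>f - c\<close>, hence of
  \<open>A\<close>. On \<open>A\<close> the two maps agree, and under \<open>\<pi>\<close> only its
  values on the support of \<open>u\<close> matter, where it is at most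
  \<open>\<kappa>\<close>.\<close>

lemma variance_localized:
  assumes f: "continuous_on X f" and eq: "\<phi> (rfun X f) = \<pi> (rfun X f)"
    and A: "continuous_on X A" and eqA: "\<phi> (rfun X A) = \<pi> (rfun X A)"
    and dom: "\<And>x. x \<in> X \<Longrightarrow> (f x - c)\<^sup>2 \<le> A x"
    and u: "continuous_on X u" and U: "\<And>x. x \<in> X \<Longrightarrow> u x \<noteq> 0 \<Longrightarrow> A x \<le> \<kappa>"
  shows "variance f (\<pi> (rfun X u) v) \<le> \<kappa> * pi_form (\<lambda>x. u x * u x) v"
proof -
  define w where "w = \<pi> (rfun X u) v"
  have one: "continuous_on X (\<lambda>_. 1::real)"
    by simp
  have forms: "phi_form f w = pi_form f w" "phi_form A w = pi_form A w"
    using eq eqA by (simp_all add: phi_form_def pi_form_def)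
  have expand: "(\<lambda>x. (f x - c)\<^sup>2) = (\<lambda>x. f x * f x + ((- (2 * c)) * f x + c\<^sup>2 * 1))"
    by (auto simp: power2_eq_square algebra_simps)
  have ff: "continuous_on X (\<lambda>x. f x * f x)" "continuous_on X (\<lambda>x. (- (2 * c)) * f x)"
    "continuous_on X (\<lambda>x. (- (2 * c)) * f x + c\<^sup>2 * 1)" "continuous_on X (\<lambda>x. c\<^sup>2 * (1::real))"
    using f by (auto intro!: continuous_intros)
  have phi: "phi_form (\<lambda>x. (f x - c)\<^sup>2) w = phi_form (\<lambda>x. f x * f x) w - 2 * c * phi_form f w + c\<^sup>2 * (norm w)\<^sup>2"
    unfolding expand by (simp only: phi_form_add[OF ff(1,3)] phi_form_add[OF ff(2,4)]
        phi_form_scale[OF f] phi_form_scale[OF one] phi_form_one)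
  have pi: "pi_form (\<lambda>x. (f x - c)\<^sup>2) w = pi_form (\<lambda>x. f x * f x) w - 2 * c * pi_form f w + c\<^sup>2 * (norm w)\<^sup>2"
    unfolding expand by (simp only: pi_form_add[OF ff(1,3)] pi_form_add[OF ff(2,4)]
        pi_form_scale[OF f] pi_form_scale[OF one] pi_form_one)
  have cont: "continuous_on X (\<lambda>x. (f x - c)\<^sup>2)"
    using f by (intro continuous_intros)
  have "pi_form (\<lambda>_. 0) w \<le> pi_form (\<lambda>x. (f x - c)\<^sup>2) w"
    by (rule pi_form_mono) (use cont in auto)
  then have "pi_form (\<lambda>x. (f x - c)\<^sup>2) w \<ge> 0"
    using pi_form_scale[OF one, of 0 w] by simp
  then have "variance f w \<le> phi_form (\<lambda>x. (f x - c)\<^sup>2) w"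
    unfolding variance_def norm_pi[OF f] phi using pi forms by simp
  also have "\<dots> \<le> phi_form A w"
    by (rule phi_form_mono[OF cont A dom])
  also have "\<dots> = pi_form (\<lambda>x. A x * (u x * u x)) v"
    unfolding forms unfolding w_def by (rule pi_form_mult[OF u A, symmetric])
  also have "\<dots> \<le> pi_form (\<lambda>x. \<kappa> * (u x * u x)) v"
  proof (rule pi_form_mono)
    show "A x * (u x * u x) \<le> \<kappa> * (u x * u x)" if "x \<in> X" for x
      using U[OF that] by (cases "u x = 0") (auto intro: mult_right_mono)
  qed (use A u in \<open>auto intro: continuous_intros\<close>)
  also have "\<dots> = \<kappa> * pi_form (\<lambda>x. u x * u x) v"
    using u by (intro pi_form_scale continuous_intros)
  finally show ?thesis
    by (simp add: w_def)
qed

lemma pi_sum: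
  assumes "finite I" "\<And>i. i \<in> I \<Longrightarrow> continuous_on X (u i)"
  shows "\<pi> (rfun X (\<lambda>x. \<Sum>i\<in>I. u i x)) v = (\<Sum>i\<in>I. \<pi> (rfun X (u i)) v)"
  using assms
proof (induction I rule: finite_induct)
  case empty
  have "\<pi> (\<lambda>x. 0 * cfun_one X x) v = 0 *\<^sub>C \<pi> (cfun_one X) v"
    by (rule pi_scale) (auto simp: cfun_one_eq_rfun)
  then show ?case
    using scaleC_of_real[of 0 "\<pi> (cfun_one X) v"] by (simp add: rfun_zero)
next
  case (insert i I)
  have "continuous_on X (\<lambda>x. \<Sum>i\<in>I. u i x)"
    using insert by (intro continuous_intros) auto
  then show ?case
    using insert by (simp add: rfun_add pi_add rfun_in_cfun_algebra plus_blinfun.rep_eq)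
qed

text \<open>The vectors \<open>\<pi>(u i) v\<close> sum to \<open>v\<close>. Their squared norms sum
  to at most that of \<open>v\<close>, because values in the unit interval that sum to 1 have
  squares that sum to at most 1.\<close>

lemma variance_le_partition:
  fixes u A :: "'i \<Rightarrow> 'a \<Rightarrow> real"
  assumes f: "continuous_on X f" and eq: "\<phi> (rfun X f) = \<pi> (rfun X f)"
    and I: "finite I"
    and u: "\<And>i. i \<in> I \<Longrightarrow> continuous_on X (u i)" "\<And>i x. i \<in> I \<Longrightarrow> x \<in> X \<Longrightarrow> u i x \<ge> 0"
      "\<And>x. x \<in> X \<Longrightarrow> (\<Sum>i\<in>I. u i x) = 1"
    and A: "\<And>i. i \<in> I \<Longrightarrow> continuous_on X (A i)" "\<And>i. i \<in> I \<Longrightarrow> \<phi> (rfun X (A i)) = \<pi> (rfun X (A i))"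
      "\<And>i x. i \<in> I \<Longrightarrow> x \<in> X \<Longrightarrow> (f x - c i)\<^sup>2 \<le> A i x"
      "\<And>i x. i \<in> I \<Longrightarrow> x \<in> X \<Longrightarrow> u i x \<noteq> 0 \<Longrightarrow> A i x \<le> \<kappa> i"
      "\<And>i. i \<in> I \<Longrightarrow> \<kappa> i \<ge> 0"
  shows "variance f v \<le> (\<Sum>i\<in>I. \<kappa> i) * (norm v)\<^sup>2"
proof -
  have form_nonneg: "pi_form (\<lambda>x. u i x * u i x) v \<ge> 0" if "i \<in> I" for i
    using norm_pi[OF u(1)[OF that], of v] by (metis zero_le_power2)
  have cont: "continuous_on X (\<lambda>x. \<Sum>i\<in>J. u i x * u i x)" if "J \<subseteq> I" for J
    using u(1) that by (intro continuous_intros) auto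
  have form_sum: "(\<Sum>i\<in>J. pi_form (\<lambda>x. u i x * u i x) v) = pi_form (\<lambda>x. \<Sum>i\<in>J. u i x * u i x) v"
    if "J \<subseteq> I" for J
    using finite_subset[OF that I] that
  proof (induction J rule: finite_induct)
    case empty
    show ?case using pi_form_scale[of "\<lambda>_. 1" 0 v] by simp
  next
    case (insert j J)
    then show ?case
      by (simp add: pi_form_add continuous_on_mult u(1) cont)
  qed
  have "rfun X (\<lambda>x. \<Sum>i\<in>I. u i x) = cfun_one X"
    unfolding cfun_one_eq_rfun by (rule rfun_cong) (rule u(3))
  then have "v = (\<Sum>i\<in>I. \<pi> (rfun X (u i)) v)"
    using pi_sum[where u = u and v = v, OF I] u(1) by (simp add: pi_one)
  then have "variance f v = variance f (\<Sum>i\<in>I. \<pi> (rfun X (u i)) v)"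
    by (rule arg_cong)
  also have "\<dots> \<le> (\<Sum>i\<in>I. \<kappa> i) * (\<Sum>i\<in>I. pi_form (\<lambda>x. u i x * u i x) v)"
    by (rule variance_sum_le[OF f eq I])
      (auto intro!: A form_nonneg variance_localized[OF f eq A(1) A(2)] u(1))
  also have "\<dots> \<le> (\<Sum>i\<in>I. \<kappa> i) * (norm v)\<^sup>2"
  proof (rule mult_left_mono)
    have "pi_form (\<lambda>x. \<Sum>i\<in>I. u i x * u i x) v \<le> pi_form (\<lambda>_. 1) v"
    proof (rule pi_form_mono)
      fix x assume x: "x \<in> X"
      have "u i x \<le> 1" if "i \<in> I" for i
        using member_le_sum[of i I "\<lambda>i. u i x"] u(2,3) x that I by auto
      then have "(\<Sum>i\<in>I. u i x * u i x) \<le> (\<Sum>i\<in>I. u i x)"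
        using u(2) x by (intro sum_mono mult_left_le) auto
      then show "(\<Sum>i\<in>I. u i x * u i x) \<le> 1"
        using u(3)[OF x] by simp
    qed (use cont in auto)
    then show "(\<Sum>i\<in>I. pi_form (\<lambda>x. u i x * u i x) v) \<le> (norm v)\<^sup>2"
      by (simp add: form_sum pi_form_one)
    show "0 \<le> (\<Sum>i\<in>I. \<kappa> i)"
      by (intro sum_nonneg A(5))
  qed
  finally show ?thesis .
qed

section \<open>Multiplicative domain and uniqueness by density\<close>

lemma multiplicative_domain:
  assumes f: "continuous_on X f" and eq: "\<phi> (rfun X f) = \<pi> (rfun X f)"
    and var: "\<And>v. variance f v = 0" and g: "g \<in> cfun_algebra X"
  shows "\<phi> (\<lambda>x. rfun X f x * g x) = \<pi> (rfun X f) o\<^sub>L \<phi> g"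
proof (rule blinfun_eqI)
  fix w
  define T where "T = \<pi> (rfun X f)"
  define S where "S = \<phi> (rfun X (\<lambda>x. f x * f x))"
  define G where "G = \<phi> g"
  define R where "R = \<phi> (\<lambda>x. rfun X f x * g x)"
  define R' where "R' = \<phi> (\<lambda>x. cnj (g x) * rfun X f x)"
  define G' where "G' = \<phi> (\<lambda>x. cnj (g x))"
  define Q where "Q = \<phi> (\<lambda>x. cnj (g x) * g x)"
  have lin: "T (c *\<^sub>C x) = c *\<^sub>C T x" "S (c *\<^sub>C x) = c *\<^sub>C S x" "R' (c *\<^sub>C x) = c *\<^sub>C R' x"
    "G' (c *\<^sub>C x) = c *\<^sub>C G' x" for c x
    using pi_bounded[of "rfun X f"] phi_bounded[of "rfun X (\<lambda>x. f x * f x)"]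
      phi_bounded[of "\<lambda>x. cnj (g x) * rfun X f x"] phi_bounded[of "\<lambda>x. cnj (g x)"]
      f g by (auto simp: bounded_ops_def T_def S_def R'_def G'_def continuous_on_mult
        rfun_in_cfun_algebra cfun_algebra_mult cfun_algebra_cnj)
  \<comment> \<open>Positivity is applied to the 3 x 3 matrix of the row \<open>(1, f, g)\<close>,
    as in Choi's theorem on multiplicative domains.\<close>
  define h where "h = (\<lambda>i::nat. if i = 0 then cfun_one X else if i = 1 then rfun X f else g)"
  have h: "h i \<in> cfun_algebra X" for i
    using f g by (auto simp: h_def cfun_one_eq_rfun)
  have one: "cfun_one X x * g x = g x" "cfun_one X x * cnj (g x) = cnj (g x)" "cfun_one X x * rfun X f x = rfun X f x"
     "cnj (cfun_one X x) = cfun_one X x" "cfun_one X x * cfun_one X x = cfun_one X x" for x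
    using g by (auto simp: cfun_one_def cfun_algebra_def rfun_def)
  have row: "(\<lambda>x. cnj (h 0 x) * h 0 x) = cfun_one X" "(\<lambda>x. cnj (h 0 x) * h 1 x) = rfun X f"
    "(\<lambda>x. cnj (h 0 x) * h 2 x) = g" "(\<lambda>x. cnj (h 1 x) * h 0 x) = rfun X f"
    "(\<lambda>x. cnj (h 1 x) * h 1 x) = rfun X (\<lambda>x. f x * f x)"
    "(\<lambda>x. cnj (h 1 x) * h 2 x) = (\<lambda>x. rfun X f x * g x)"
    "(\<lambda>x. cnj (h 2 x) * h 0 x) = (\<lambda>x. cnj (g x))"
    "(\<lambda>x. cnj (h 2 x) * h 1 x) = (\<lambda>x. cnj (g x) * rfun X f x)"
    "(\<lambda>x. cnj (h 2 x) * h 2 x) = (\<lambda>x. cnj (g x) * g x)"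
    using one by (auto simp: h_def rfun_mult rfun_cnj[THEN fun_cong] mult.commute)
  have *: "cinner v0 (v0 + T v1 + G v2) + cinner v1 (T v0 + S v1 + R v2)
      + cinner v2 (G' v0 + R' v1 + Q v2) \<in> \<real>\<^sub>\<ge>\<^sub>0" for v0 v1 v2
    using ucp_map_row[where g = h and n = 3 and v = "\<lambda>i. if i = 0 then v0 else if i = 1 then v1 else v2", OF ucp h]
    by (simp add: numeral_3_eq_3 row[unfolded One_nat_def numeral_2_eq_2] phi_one eq
        T_def S_def R_def R'_def G_def G'_def Q_def add.assoc)
  \<comment> \<open>The choice \<open>v0 = - T v1 - G v2\<close> cancels the first row. In the
    remaining 2 x 2 form the entry \<open>S - T T\<close> will vanish, which forces the off-diagonal
    entry \<open>R - T G\<close> to vanish too.\<close>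
  have **: "cinner v1 (S v1 - T (T v1)) + cinner v1 (R v2 - T (G v2)) + cinner v2 (R' v1 - G' (T v1))
      + cinner v2 (Q v2 - G' (G v2)) \<in> \<real>\<^sub>\<ge>\<^sub>0" for v1 v2
    using *[of "- T v1 - G v2" v1 v2]
    by (simp add: blinfun.diff_right blinfun.minus_right cinner_add_right cinner_diff_right algebra_simps)
  have S: "S = T o\<^sub>L T"
  proof -
    \<comment> \<open>Zero variance equates only the real parts of the two quadratic forms. The
      imaginary parts vanish, by positivity for \<open>S\<close> and by self-adjointness for
      \<open>\<pi>\<close>, and polarisation then identifies the operators.\<close>
    have SS: "S = \<pi> (rfun X (\<lambda>x. f x * f x))"
    proof (rule bounded_ops_eqI)
      show "S \<in> bounded_ops"
        unfolding S_def using f by (intro phi_bounded rfun_in_cfun_algebra continuous_intros)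
      show "\<pi> (rfun X (\<lambda>x. f x * f x)) \<in> bounded_ops"
        using f by (intro pi_bounded rfun_in_cfun_algebra continuous_intros)
      fix v
      have ff: "continuous_on X (\<lambda>x. f x * f x)"
        using f by (intro continuous_intros)
      have "Re (cinner v (S v)) = Re (cinner v (\<pi> (rfun X (\<lambda>x. f x * f x)) v))"
        using var[of v] by (simp add: variance_def norm_pi[OF f] phi_form_def pi_form_def S_def)
      moreover have "cinner v (S v) \<in> \<real>\<^sub>\<ge>\<^sub>0"
        using *[of 0 v 0] by simp
      moreover have "Im (cinner v (\<pi> (rfun X (\<lambda>x. f x * f x)) v)) = 0"
        by (rule pi_form_real[OF ff])
      ultimately show "cinner v (S v) = cinner v (\<pi> (rfun X (\<lambda>x. f x * f x)) v)"
        by (simp add: complex_eq_iff complex_nonneg_Reals_iff)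
    qed
    then show ?thesis
      using f by (simp add: rfun_mult pi_mult rfun_in_cfun_algebra T_def)
  qed
  have "R w - T (G w) = 0"
  proof (rule cinner_eq_zeroD)
    fix v
    show "cinner v (R w - T (G w)) = 0"
    proof (rule nonneg_affine_imp_zero)
      fix c
      show "cnj c * cinner v (R w - T (G w)) + c * cinner w (R' v - G' (T v))
          + cinner w (Q w - G' (G w)) \<in> \<real>\<^sub>\<ge>\<^sub>0"
        using **[of "c *\<^sub>C v" w]
        by (simp add: S lin cinner_scaleC_left cinner_scaleC_right cinner_diff_right algebra_simps)
    qed
  qed
  then show "R w = (T o\<^sub>L G) w"
    by simp
qed

text \<open>Agreement at \<open>f\<close> is strengthened by a multiplicativity relation with every
  \<open>g\<close>, because in this form it passes to products.\<close>

definition rigid_at :: "('a \<Rightarrow> real) \<Rightarrow> bool" where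
  "rigid_at f \<longleftrightarrow> continuous_on X f \<and> \<phi> (rfun X f) = \<pi> (rfun X f) \<and>
     (\<forall>g\<in>cfun_algebra X. \<phi> (\<lambda>x. rfun X f x * g x) = \<pi> (rfun X f) o\<^sub>L \<phi> g)"

lemma rigid_at_const: "rigid_at (\<lambda>_. c)"
  unfolding rigid_at_def
proof (intro conjI ballI)
  have one: "cfun_one X \<in> cfun_algebra X"
    by (auto simp: cfun_one_eq_rfun)
  have rf: "rfun X (\<lambda>_. c) = (\<lambda>x. of_real c * cfun_one X x)"
    by (auto simp: rfun_def cfun_one_def)
  have pi: "\<pi> (rfun X (\<lambda>_. c)) v = of_real c *\<^sub>C v" and phi: "\<phi> (rfun X (\<lambda>_. c)) v = of_real c *\<^sub>C v" for v
    unfolding rf by (simp_all only: pi_scale[OF one] phi_scale[OF one] pi_one phi_one) simp_all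
  show "\<phi> (rfun X (\<lambda>_. c)) = \<pi> (rfun X (\<lambda>_. c))"
    by (rule blinfun_eqI) (simp add: pi phi)
  fix g assume g: "g \<in> cfun_algebra X"
  then have "(\<lambda>x. rfun X (\<lambda>_. c) x * g x) = (\<lambda>x. of_real c * g x)"
    by (auto simp: rfun_def cfun_algebra_def)
  then show "\<phi> (\<lambda>x. rfun X (\<lambda>_. c) x * g x) = \<pi> (rfun X (\<lambda>_. c)) o\<^sub>L \<phi> g"
    by (intro blinfun_eqI) (simp add: phi_scale[OF g] pi)
qed simp

lemma rigid_at_add:
  assumes "rigid_at f" "rigid_at g"
  shows "rigid_at (\<lambda>x. f x + g x)"
  unfolding rigid_at_def
proof (intro conjI ballI)
  fix h assume h: "h \<in> cfun_algebra X"
  have fg: "rfun X f \<in> cfun_algebra X" "rfun X g \<in> cfun_algebra X"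
    using assms by (auto simp: rigid_at_def)
  have "\<phi> (\<lambda>x. rfun X f x * h x + rfun X g x * h x)
      = \<phi> (\<lambda>x. rfun X f x * h x) + \<phi> (\<lambda>x. rfun X g x * h x)"
    using fg h by (intro phi_add) auto
  then show "\<phi> (\<lambda>x. rfun X (\<lambda>x. f x + g x) x * h x) = \<pi> (rfun X (\<lambda>x. f x + g x)) o\<^sub>L \<phi> h"
    using assms h fg
    by (intro blinfun_eqI) (simp add: rigid_at_def rfun_add pi_add distrib_right plus_blinfun.rep_eq)
qed (use assms in \<open>auto simp: rigid_at_def rfun_add phi_add pi_add rfun_in_cfun_algebra intro!: continuous_intros\<close>)

lemma rigid_at_mult:
  assumes "rigid_at f" "rigid_at g"
  shows "rigid_at (\<lambda>x. f x * g x)"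
  unfolding rigid_at_def
proof (intro conjI ballI)
  have fg: "rfun X f \<in> cfun_algebra X" "rfun X g \<in> cfun_algebra X"
    using assms by (auto simp: rigid_at_def)
  show "\<phi> (rfun X (\<lambda>x. f x * g x)) = \<pi> (rfun X (\<lambda>x. f x * g x))"
    using assms fg by (simp add: rigid_at_def rfun_mult pi_mult)
  fix h assume h: "h \<in> cfun_algebra X"
  then have "\<phi> (\<lambda>x. rfun X f x * (rfun X g x * h x)) = \<pi> (rfun X f) o\<^sub>L (\<pi> (rfun X g) o\<^sub>L \<phi> h)"
    using assms fg by (simp add: rigid_at_def cfun_algebra_mult)
  then show "\<phi> (\<lambda>x. rfun X (\<lambda>x. f x * g x) x * h x) = \<pi> (rfun X (\<lambda>x. f x * g x)) o\<^sub>L \<phi> h"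
    using fg by (intro blinfun_eqI) (simp add: rfun_mult pi_mult mult.assoc)
qed (use assms in \<open>auto simp: rigid_at_def intro!: continuous_intros\<close>)

lemma rigid_at_sum:
  assumes "finite I" "\<And>i. i \<in> I \<Longrightarrow> rigid_at (f i)"
  shows "rigid_at (\<lambda>x. \<Sum>i\<in>I. f i x)"
  using assms by (induction I rule: finite_induct) (simp_all add: rigid_at_const rigid_at_add)

lemma rigid_at_variance:
  assumes "continuous_on X f" "\<phi> (rfun X f) = \<pi> (rfun X f)" "\<And>v. variance f v = 0"
  shows "rigid_at f"
  using assms multiplicative_domain unfolding rigid_at_def by blast

text \<open>Monotonicity plays the role of norm continuity: from
  \<open>q - d \<le> f \<le> q + d\<close> both forms at \<open>f\<close> lie in the same short
  interval. Polarisation then gives the operators, and a general \<open>g\<close> is split into real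
  and imaginary parts.\<close>

lemma extension_unique_if_approx:
  assumes dense: "\<And>f e. continuous_on X f \<Longrightarrow> 0 < e \<Longrightarrow>
      \<exists>q. continuous_on X q \<and> \<phi> (rfun X q) = \<pi> (rfun X q) \<and> (\<forall>x\<in>X. \<bar>f x - q x\<bar> < e)"
    and g: "g \<in> cfun_algebra X"
  shows "\<phi> g = \<pi> g"
proof -
  have one: "continuous_on X (\<lambda>_. 1::real)"
    by simp
  have form: "phi_form f v = pi_form f v" if f: "continuous_on X f" for f v
  proof -
    have "\<bar>phi_form f v - pi_form f v\<bar> \<le> e" if "e > 0" for e
    proof -
      define d where "d = e / (2 * ((norm v)\<^sup>2 + 1))"
      have pos: "(norm v)\<^sup>2 + 1 > 0"
        by (smt (verit) zero_le_power2)
      then have d: "d > 0" "2 * d * (norm v)\<^sup>2 \<le> e"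
        using that by (auto simp: d_def field_simps)
      obtain q where q: "continuous_on X q" "\<phi> (rfun X q) = \<pi> (rfun X q)" "\<And>x. x \<in> X \<Longrightarrow> \<bar>f x - q x\<bar> < d"
        using dense[OF f d(1)] by blast
      have shift: "phi_form (\<lambda>x. q x + c * 1) v = phi_form q v + c * (norm v)\<^sup>2"
        "pi_form (\<lambda>x. q x + c * 1) v = pi_form q v + c * (norm v)\<^sup>2" for c
        using q(1) phi_form_add[of q "\<lambda>x. c * 1" v] phi_form_scale[OF one, of c v]
          pi_form_add[of q "\<lambda>x. c * 1" v] pi_form_scale[OF one, of c v]
        by (simp_all add: phi_form_one pi_form_one)
      have qc: "continuous_on X (\<lambda>x. q x + c * 1)" for c
        using q(1) by (intro continuous_intros)
      have le: "f x \<le> q x + d * 1" "q x + - d * 1 \<le> f x" if "x \<in> X" for x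
        using q(3)[OF that] by linarith+
      have "phi_form f v \<le> phi_form (\<lambda>x. q x + d * 1) v" "pi_form f v \<le> pi_form (\<lambda>x. q x + d * 1) v"
        by (intro phi_form_mono pi_form_mono f qc, use le(1) in blast)+
      moreover have "phi_form (\<lambda>x. q x + (- d) * 1) v \<le> phi_form f v" "pi_form (\<lambda>x. q x + (- d) * 1) v \<le> pi_form f v"
        by (intro phi_form_mono pi_form_mono f qc, use le(2) in blast)+
      moreover have "phi_form q v = pi_form q v"
        using q(2) by (simp add: phi_form_def pi_form_def)
      moreover have "2 * d * (norm v)\<^sup>2 = d * (norm v)\<^sup>2 + d * (norm v)\<^sup>2"
        by simp
      ultimately show ?thesis
        using d(2) unfolding shift unfolding mult_minus_left abs_le_iff by linarith
    qed
    then have "\<bar>phi_form f v - pi_form f v\<bar> \<le> 0"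
      by (rule field_le_epsilon) simp
    then show ?thesis by simp
  qed
  have real: "\<phi> (rfun X f) = \<pi> (rfun X f)" if f: "continuous_on X f" for f
  proof (rule bounded_ops_eqI)
    fix v
    have "Im (cinner v (\<pi> (rfun X f) v)) = 0"
      by (rule pi_form_real[OF f])
    moreover have "Im (cinner v (\<phi> (rfun X f) v)) = 0"
    proof -
      \<comment> \<open>\<open>f\<close> is a difference of two squares of continuous functions, and
        the form of \<open>\<phi>\<close> is real on each of them by positivity.\<close>
      define f1 where "f1 = (\<lambda>x. sqrt (max (f x) 0))"
      define f2 where "f2 = (\<lambda>x. sqrt (max (- f x) 0))"
      have f12: "continuous_on X f1" "continuous_on X f2"
        unfolding f1_def f2_def using f by (auto intro!: continuous_intros)
      have pos: "Im (cinner v (\<phi> (rfun X (\<lambda>x. h x * h x)) v)) = 0" if "continuous_on X h" for h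
        using ucp_map_row[OF ucp, where g = "\<lambda>_. rfun X h" and n = 1 and v = "\<lambda>_. v"] that
        by (simp add: rfun_mult rfun_in_cfun_algebra rfun_cnj[THEN fun_cong] complex_nonneg_Reals_iff)
      have sq: "continuous_on X (\<lambda>x. f1 x * f1 x)" "continuous_on X (\<lambda>x. (-1) * (f2 x * f2 x))"
         "continuous_on X (\<lambda>x. f2 x * f2 x)"
        using f12 by (auto intro!: continuous_intros)
      have "rfun X f = rfun X (\<lambda>x. f1 x * f1 x + (-1) * (f2 x * f2 x))"
        by (rule rfun_cong) (auto simp: f1_def f2_def max_def)
      then have "\<phi> (rfun X f) v = \<phi> (rfun X (\<lambda>x. f1 x * f1 x + (-1) * (f2 x * f2 x))) v"
        by (rule arg_cong)
      also have "\<dots> = \<phi> (rfun X (\<lambda>x. f1 x * f1 x)) v + of_real (-1) *\<^sub>C \<phi> (rfun X (\<lambda>x. f2 x * f2 x)) v"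
        using sq by (simp only: rfun_add phi_add rfun_in_cfun_algebra cfun_algebra_scale plus_blinfun.rep_eq
            rfun_scale[where r = "-1" and f = "\<lambda>x. f2 x * f2 x"] phi_scale)
      finally have "\<phi> (rfun X f) v = \<dots>" .
      then show ?thesis
        using pos[OF f12(1)] pos[OF f12(2)]
        by (simp only: cinner_add_right cinner_scaleC_right) simp
    qed
    ultimately show "cinner v (\<phi> (rfun X f) v) = cinner v (\<pi> (rfun X f) v)"
      using form[OF f, of v] by (simp add: complex_eq_iff phi_form_def pi_form_def)
  qed (use f in \<open>auto intro: phi_bounded pi_bounded\<close>)
  have Re: "continuous_on X (\<lambda>x. Re (g x))" and Im: "continuous_on X (\<lambda>x. Im (g x))"
    using g by (auto simp: cfun_algebra_def intro: continuous_intros)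
  have split: "g = (\<lambda>x. rfun X (\<lambda>x. Re (g x)) x + \<i> * rfun X (\<lambda>x. Im (g x)) x)"
    using g by (auto simp: rfun_def cfun_algebra_def complex_eq_iff)
  have "\<phi> (\<lambda>x. \<i> * rfun X (\<lambda>x. Im (g x)) x) = \<pi> (\<lambda>x. \<i> * rfun X (\<lambda>x. Im (g x)) x)"
    using Im by (intro blinfun_eqI) (simp add: phi_scale pi_scale rfun_in_cfun_algebra real)
  then have "\<phi> (\<lambda>x. rfun X (\<lambda>x. Re (g x)) x + \<i> * rfun X (\<lambda>x. Im (g x)) x)
    = \<pi> (\<lambda>x. rfun X (\<lambda>x. Re (g x)) x + \<i> * rfun X (\<lambda>x. Im (g x)) x)"
    using Re Im by (simp add: phi_add pi_add rfun_in_cfun_algebra cfun_algebra_scale real)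
  then show ?thesis
    using split by simp
qed

end

text \<open>The functions satisfying \<open>rigid_at\<close> contain the constants and the
  coordinates and are closed under sums and products, so they include all real polynomial functions,
  which are uniformly dense on the compact set \<open>X\<close>.\<close>

lemma extension_unique_if_variance_zero:
  fixes X :: "'a::euclidean_space set"
    and \<pi> \<phi> :: "('a \<Rightarrow> complex) \<Rightarrow> ('h::chilbert_space \<Rightarrow>\<^sub>L 'h)"
  assumes "ucp_extension X \<pi> \<phi>" and X: "compact X"
    and eq: "\<And>b. b \<in> Basis \<Longrightarrow> \<phi> (rfun X (\<lambda>x. x \<bullet> b)) = \<pi> (rfun X (\<lambda>x. x \<bullet> b))"
    and var: "\<And>b v. b \<in> Basis \<Longrightarrow> ucp_extension.variance X \<pi> \<phi> (\<lambda>x. x \<bullet> b) v = 0"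
    and g: "g \<in> cfun_algebra X"
  shows "\<phi> g = \<pi> g"
proof -
  interpret ucp_extension X \<pi> \<phi> by fact
  have poly: "rigid_at q" if "real_polynomial_function q" for q
    using that
  proof (induction q rule: real_polynomial_function.induct)
    case (linear f)
    then interpret bounded_linear f .
    have "f = (\<lambda>x. \<Sum>b\<in>Basis. f b * (x \<bullet> b))"
      by (rule ext) (subst (1) euclidean_representation[symmetric], simp only: sum scaleR, simp add: mult.commute)
    moreover have "rigid_at (\<lambda>x. x \<bullet> b)" if "b \<in> Basis" for b
      using that by (intro rigid_at_variance eq var continuous_intros)
    then have "rigid_at (\<lambda>x. \<Sum>b\<in>Basis. f b * (x \<bullet> b))"
      by (intro rigid_at_sum rigid_at_mult rigid_at_const) auto
    ultimately show ?case by simp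
  qed (auto intro: rigid_at_const rigid_at_add rigid_at_mult)
  show ?thesis
  proof (rule extension_unique_if_approx[OF _ g])
    fix f :: "'a \<Rightarrow> real" and e :: real
    assume "continuous_on X f" "0 < e"
    then obtain q where "real_polynomial_function q" "\<And>x. x \<in> X \<Longrightarrow> \<bar>f x - q x\<bar> < e"
      using Stone_Weierstrass_real_polynomial_function[OF X] by metis
    then show "\<exists>q. continuous_on X q \<and> \<phi> (rfun X q) = \<pi> (rfun X q) \<and> (\<forall>x\<in>X. \<bar>f x - q x\<bar> < e)"
      using poly unfolding rigid_at_def by blast
  qed
qed

subsection \<open>Hyperrigidity\<close>

lemma affine_in_affine_functions:
  "rfun (extreme_points K) (\<lambda>x. c + b \<bullet> x) \<in> affine_functions (K :: 'a::euclidean_space set)"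
  unfolding affine_functions_def
proof (intro CollectI conjI exI[of _ "\<lambda>x. complex_of_real (c + b \<bullet> x)"])
  show "rfun (extreme_points K) (\<lambda>x. c + b \<bullet> x) \<in> cfun_algebra (extreme_points K)"
    by (intro rfun_in_cfun_algebra continuous_intros)
  have lin: "c + b \<bullet> ((1 - t) *\<^sub>R x + t *\<^sub>R y) = (1 - t) * (c + b \<bullet> x) + t * (c + b \<bullet> y)" for t x y
    by (simp add: algebra_simps)
  show "continuous_affine_on K (\<lambda>x. complex_of_real (c + b \<bullet> x))"
    unfolding continuous_affine_on_def lin scaleR_conv_of_real
    by (auto intro!: continuous_intros)
qed (simp add: rfun_def)

text \<open>The partition is first indexed by the open sets themselves. As several indices may share
  one set, each function is then split evenly among the indices of its set, \<open>n i\<close> being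
  their number.\<close>

lemma finite_partition_of_unity:
  fixes S :: "'a::metric_space set"
  assumes I: "finite I" and S: "S \<subseteq> (\<Union>i\<in>I. U i)" and U: "\<And>i. i \<in> I \<Longrightarrow> open (U i)"
  obtains u :: "'i \<Rightarrow> 'a \<Rightarrow> real" where "\<And>i. i \<in> I \<Longrightarrow> continuous_on S (u i)"
    "\<And>i x. i \<in> I \<Longrightarrow> x \<in> S \<Longrightarrow> u i x \<ge> 0" "\<And>i x. i \<in> I \<Longrightarrow> x \<in> S \<Longrightarrow> u i x \<noteq> 0 \<Longrightarrow> x \<in> U i"
    "\<And>x. x \<in> S \<Longrightarrow> (\<Sum>i\<in>I. u i x) = 1"
proof -
  obtain F :: "['a set, 'a] \<Rightarrow> real" where F: "\<And>T. T \<in> U ` I \<Longrightarrow> continuous_on S (F T) \<and> (\<forall>x \<in> S. 0 \<le> F T x)"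
    "\<And>x T. \<lbrakk>T \<in> U ` I; x \<in> S; x \<notin> T\<rbrakk> \<Longrightarrow> F T x = 0"
    "\<And>x. x \<in> S \<Longrightarrow> supp_sum (\<lambda>W. F W x) (U ` I) = 1"
  proof (rule subordinate_partition_of_unity[of S "U ` I"])
    show "S \<subseteq> \<Union>(U ` I)"
      using S by simp
    show "open T" if "T \<in> U ` I" for T
      using U that by auto
    show "\<exists>V. open V \<and> x \<in> V \<and> finite {T \<in> U ` I. T \<inter> V \<noteq> {}}" for x
      using I by (intro exI[of _ UNIV]) simp
  qed (rule that, assumption+)
  define n where "n = (\<lambda>i. real (card {j\<in>I. U j = U i}))"
  have n: "n i > 0" if "i \<in> I" for i
    using that I by (auto simp: n_def card_gt_0_iff)
  define u where "u = (\<lambda>i x. F (U i) x / n i)"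
  show ?thesis
  proof (rule that[of u])
    fix i assume i: "i \<in> I"
    show "continuous_on S (u i)"
      unfolding u_def using F(1)[of "U i"] n[OF i] i by (intro continuous_intros) auto
    fix x assume x: "x \<in> S"
    show "u i x \<ge> 0"
      using F(1)[of "U i"] n[OF i] i x by (simp add: u_def)
    show "x \<in> U i" if "u i x \<noteq> 0"
      using F(2)[of "U i" x] i x that by (auto simp: u_def)
  next
    fix x assume x: "x \<in> S"
    have "(\<Sum>i\<in>I. u i x) = (\<Sum>T\<in>U ` I. \<Sum>i\<in>{i\<in>I. U i = T}. u i x)"
      by (rule sum.image_gen[OF I])
    also have "\<dots> = (\<Sum>T\<in>U ` I. F T x)"
    proof (rule sum.cong[OF refl])
      fix T assume "T \<in> U ` I"
      then obtain j where j: "j \<in> I" "T = U j" by auto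
      have "(\<Sum>i\<in>{i\<in>I. U i = T}. u i x) = (\<Sum>i\<in>{i\<in>I. U i = T}. F T x / n j)"
        by (rule sum.cong) (auto simp: u_def n_def j)
      then show "(\<Sum>i\<in>{i\<in>I. U i = T}. u i x) = F T x"
        using n[OF j(1)] by (simp add: j(2)) (simp add: n_def)
    qed
    also have "\<dots> = supp_sum (\<lambda>W. F W x) (U ` I)"
      unfolding supp_sum_def using I by (intro sum.mono_neutral_right) (auto simp: support_on_def)
    finally show "(\<Sum>i\<in>I. u i x) = 1"
      using F(3)[OF x] by simp
  qed
qed

theorem theorem3p8:
  fixes K :: "(real ^ 2) set"
  assumes "convex K" and "compact K"
  shows "hyperrigid TYPE('h::chilbert_space) (extreme_points K) (affine_functions K)"
  unfolding hyperrigid_def unique_extension_property_def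
proof (intro allI impI ballI, elim conjE)
  fix \<pi> \<phi> :: "(real ^ 2 \<Rightarrow> complex) \<Rightarrow> 'h \<Rightarrow>\<^sub>L 'h" and g
  assume hom: "unital_star_hom (extreme_points K) \<pi>" and ucp: "ucp_map (extreme_points K) \<phi>"
    and agree: "\<forall>f\<in>affine_functions K. \<phi> f = \<pi> f" and g: "g \<in> cfun_algebra (extreme_points K)"
  define X where "X = extreme_points K"
  interpret ucp_extension X \<pi> \<phi>
    by unfold_locales (use hom ucp in \<open>simp_all add: X_def\<close>)
  have XK: "X \<subseteq> K"
    by (auto simp: X_def extreme_points_def extreme_point_of_def)
  have affine: "\<phi> (rfun X (\<lambda>x. c + b \<bullet> x)) = \<pi> (rfun X (\<lambda>x. c + b \<bullet> x))" for c b
    unfolding X_def by (rule agree[rule_format, OF affine_in_affine_functions])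
  have affine_cont: "continuous_on X (\<lambda>x. c + b \<bullet> x)" for c b
    by (intro continuous_intros)
  have var: "variance (\<lambda>x. x $ i) v = 0" for i v
  proof -
    have f: "continuous_on X (\<lambda>x. x $ i)" and eq: "\<phi> (rfun X (\<lambda>x. x $ i)) = \<pi> (rfun X (\<lambda>x. x $ i))"
      using affine[of 0 "axis i 1"] affine_cont[of 0 "axis i 1"] by (simp_all add: inner_axis')
    have "variance (\<lambda>x. x $ i) v \<le> \<delta> * (norm v)\<^sup>2" if \<delta>: "\<delta> > 0" for \<delta>
    proof (rule planar_majorant_cover[OF assms \<delta>, of i])
      fix I U b c \<kappa>
      assume I: "finite I" "extreme_points K \<subseteq> (\<Union>p\<in>I. U p)" "\<And>p. p \<in> I \<Longrightarrow> open (U p)"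
        and maj: "\<And>p x. p \<in> I \<Longrightarrow> x \<in> K \<Longrightarrow> (x $ i - p $ i)\<^sup>2 \<le> c p + b p \<bullet> x"
          "\<And>p x. p \<in> I \<Longrightarrow> x \<in> K \<Longrightarrow> x \<in> U p \<Longrightarrow> c p + b p \<bullet> x \<le> \<kappa> p"
        and \<kappa>: "\<And>p. p \<in> I \<Longrightarrow> \<kappa> p \<ge> 0" "(\<Sum>p\<in>I. \<kappa> p) \<le> \<delta>"
      obtain u where u: "\<And>p. p \<in> I \<Longrightarrow> continuous_on X (u p)" "\<And>p x. p \<in> I \<Longrightarrow> x \<in> X \<Longrightarrow> u p x \<ge> 0"
        "\<And>p x. p \<in> I \<Longrightarrow> x \<in> X \<Longrightarrow> u p x \<noteq> 0 \<Longrightarrow> x \<in> U p" "\<And>x. x \<in> X \<Longrightarrow> (\<Sum>p\<in>I. u p x) = (1::real)"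
        using finite_partition_of_unity[OF I[folded X_def]] by metis
      have "variance (\<lambda>x. x $ i) v \<le> (\<Sum>p\<in>I. \<kappa> p) * (norm v)\<^sup>2"
      \<comment> \<open>On the patch of \<open>p\<close> the subtracted constant is the coordinate
        of \<open>p\<close> itself. Each majorant is affine, so \<open>\<phi>\<close> and
        \<open>\<pi>\<close> agree on it by assumption.\<close>
      proof (rule variance_le_partition[OF f eq I(1) u(1,2,4), where c = "\<lambda>p. p $ i" and A = "\<lambda>p x. c p + b p \<bullet> x"])
        fix p x assume p: "p \<in> I" "x \<in> X"
        then have x: "x \<in> K" using XK by blast
        show "(x $ i - p $ i)\<^sup>2 \<le> c p + b p \<bullet> x"
          by (rule maj(1)[OF p(1) x])
        assume "u p x \<noteq> 0"
        then show "c p + b p \<bullet> x \<le> \<kappa> p"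
          using maj(2)[OF p(1) x] u(3)[OF p] by blast
      qed (simp_all add: \<kappa>(1) affine affine_cont)
      also have "\<dots> \<le> \<delta> * (norm v)\<^sup>2"
        using \<kappa>(2) by (rule mult_right_mono) simp
      finally show ?thesis .
    qed
    note bound = this
    have "variance (\<lambda>x. x $ i) v \<le> 0 + e" if e: "e > 0" for e
    proof -
      have pos: "(norm v)\<^sup>2 + 1 > 0"
        by (smt (verit) zero_le_power2)
      have "variance (\<lambda>x. x $ i) v \<le> e / ((norm v)\<^sup>2 + 1) * (norm v)\<^sup>2"
        using e pos by (intro bound) simp
      also have "\<dots> \<le> e"
        using e pos by (simp add: field_simps)
      finally show ?thesis by simp
    qed
    then have "variance (\<lambda>x. x $ i) v \<le> 0"
      by (rule field_le_epsilon)
    then show ?thesis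
      using variance_nonneg[OF f eq, of v] by simp
  qed
  show "\<phi> g = \<pi> g"
  proof (rule extension_unique_if_variance_zero[OF ucp_extension_axioms])
    show "compact X"
      unfolding X_def by (rule compact_extreme_points_plane[OF assms])
    show "g \<in> cfun_algebra X"
      using g by (simp add: X_def)
    fix b :: "real ^ 2" assume b: "b \<in> Basis"
    show "\<phi> (rfun X (\<lambda>x. x \<bullet> b)) = \<pi> (rfun X (\<lambda>x. x \<bullet> b))"
      using affine[of 0 b] by (simp add: inner_commute)
    show "variance (\<lambda>x. x \<bullet> b) v = 0" for v
      using b var by (auto simp: Basis_vec_def inner_axis)
  qed
qed

end
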